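(* Let $\mathbf{S}=(\{A_\sigma,K_\sigma,B_\sigma\}_{\sigma\in\Sigma},C,D,I,\mathbf{e}^s)$ and $\hat{\mathbf{S}}=(\{\hat A_\sigma,\hat K_\sigma,\hat B_\sigma\}_{\sigma\in\Sigma},\hat C,\hat D,I,\mathbf{e}^s)$ both be sGLSSs of $(\mathbf{y},\mathbf{u},\boldsymbol{\mu})$ in innovation form, and assume that the asGLSSs $\mathbf{S}_s=(\{A_\sigma,K_\sigma\}_{\sigma\in\Sigma},C,I,\mathbf{e}^s)$ and $\hat{\mathbf{S}}_s=(\{\hat A_\sigma,\hat K_\sigma\}_{\sigma\in\Sigma},\hat C,I,\mathbf{e}^s)$ of $(\mathbf{y}^s,\boldsymbol{\mu})$ are both reachable and observable. Assume that for all $\sigma\in\Sigma$ the covariance matrix $E[\mathbf{e}^s(t)(\mathbf{e}^s(t))^T\boldsymbol{\mu}_\sigma^2(t)]$ is nonsingular and $$\mathrm{Im}\begin{bmatrix}B_\sigma\\ \hat B_\sigma\end{bmatrix}\subseteq\mathrm{Im}\begin{bmatrix}K_\sigma\\ \hat K_\sigma\end{bmatrix},$$ and that $\hat D=D$. Then there exists a nonsingular matrix $T$ such that for all $\sigma\in\Sigma$ $$TA_\sigma T^{-1}=\hat A_\sigma,\qquad T[K_\sigma,B_\sigma]=[\hat K_\sigma,\hat B_\sigma],\qquad CT^{-1}=\hat C.$$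
   Context: All random variables live on a fixed probability space; all processes are indexed by $t\in\mathbb{Z}$. Processes $\mathbf{u},\mathbf{y},\boldsymbol{\mu}=(\boldsymbol{\mu}_1,\dots,\boldsymbol{\mu}_{n_\mu})^T$ take values in $\mathbb{R}^{n_u},\mathbb{R}^{n_y},\mathbb{R}^{n_\mu}$. Words. $\Sigma=\{1,\dots,n_\mu\}$; $\Sigma^+$ is the set of nonempty finite words over $\Sigma$, $\epsilon$ is the empty word, $\Sigma^*=\Sigma^+\cup\{\epsilon\}$, $|w|$ is the length of $w$, and juxtaposition is concatenation. For square matrices $\{A_\sigma\}$ and $w=\sigma_1\cdots\sigma_k$, $A_w=A_{\sigma_k}\cdots A_{\sigma_1}$, $A_\epsilon=I$. For $w=\sigma_1\cdots\sigma_k\in\Sigma^+$, $\boldsymbol{\mu}_w(t)=\boldsymbol{\mu}_{\sigma_1}(t-k+1)\boldsymbol{\mu}_{\sigma_2}(t-k+2)\cdots\boldsymbol{\mu}_{\sigma_k}(t)$; $\boldsymbol{\mu}_\epsilon(t)=1$. Admissible switching. $\boldsymbol{\mu}$ is admissible if: (1) there is $\mathcal{E}\subseteq\Sigma\times\Sigma$ such that for each $\sigma\in\Sigma$ there is $\sigma'\in\Sigma$ with $(\sigma,\sigma')\in\mathcal{E}$, and, with $L$ the set of words $\sigma_1\cdots\sigma_k\in\Sigma^+$ with $(\sigma_i,\sigma_{i+1})\in\mathcal{E}$ for $i=1,\dots,k-1$, one has $\boldsymbol{\mu}_w=0$ for all $w\in\Sigma^+\setminus L$; (2) with $\mathcal{F}^{\boldsymbol{\mu},-}_t$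 the $\sigma$-algebra generated by $\{\boldsymbol{\mu}(k)\}_{k<t}$, there are positive numbers $\{p_\sigma\}_{\sigma\in\Sigma}$ such that for all $w,v\in\Sigma^+$, $\sigma,\sigma'\in\Sigma$, $t\in\mathbb{Z}$: $E[\boldsymbol{\mu}_{w\sigma}(t)\boldsymbol{\mu}_{v\sigma'}(t)\mid\mathcal{F}^{\boldsymbol{\mu},-}_t]$ equals $p_\sigma\boldsymbol{\mu}_w(t-1)\boldsymbol{\mu}_v(t-1)$ if $\sigma=\sigma'$ and $w\sigma,v\sigma\in L$, and $0$ otherwise; $E[\boldsymbol{\mu}_{w\sigma}(t)\boldsymbol{\mu}_{\sigma'}(t)\mid\mathcal{F}^{\boldsymbol{\mu},-}_t]$ equals $p_\sigma\boldsymbol{\mu}_w(t-1)$ if $\sigma=\sigma'$ and $w\sigma\in L$, and $0$ otherwise; $E[\boldsymbol{\mu}_\sigma(t)\boldsymbol{\mu}_{\sigma'}(t)\mid\mathcal{F}^{\boldsymbol{\mu},-}_t]=0$ if $\sigma\neq\sigma'$; (3) there are reals $\{\alpha_\sigma\}$ with $\sum_{\sigma}\alpha_\sigma\boldsymbol{\mu}_\sigma(t)=1$ for all $t$; (4) for all $w,v\in\Sigma^+$, $[\boldsymbol{\mu}_w,\boldsymbol{\mu}_v]^T$ is wide-sense stationary. Put $p_w=p_{\sigma_1}\cdots p_{\sigma_k}$ for $w=\sigma_1\cdots\sigma_k$. For a process $\mathbf{r}$ and $w\in\Sigma^+$: $\mathbf{z}^{\mathbf{r}}_w(t)=\mathbf{r}(t-|w|)\,\boldsymbol{\mu}_w(t-1)\frac{1}{\sqrt{p_w}}$.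 ZMWSSI. $\mathbf{r}$ is ZMWSSI (zero mean wide sense stationary w.r.t. $\boldsymbol{\mu}$) if (1) for every $t$ the $\sigma$-algebras generated by $\{\mathbf{r}(k)\}_{k\le t}$ and by $\{\boldsymbol{\mu}_\sigma(k)\}_{k\ge t,\sigma\in\Sigma}$ are conditionally independent given the one generated by $\{\boldsymbol{\mu}_\sigma(k)\}_{k<t,\sigma\in\Sigma}$; (2) the processes $\mathbf{r}$, $\mathbf{z}^{\mathbf{r}}_w$ ($w\in\Sigma^+$) are zero mean, square integrable and jointly wide-sense stationary. White noise w.r.t. $\boldsymbol{\mu}$: a ZMWSSI process $\mathbf{r}$ such that for all $w\in\Sigma^+$, $v\in\Sigma^*$, $\sigma\in\Sigma$: $E[\mathbf{z}^{\mathbf{r}}_w(t)(\mathbf{z}^{\mathbf{r}}_{\sigma v}(t))^T]=0$ if $w\ne\sigma v$, and $=E[\mathbf{z}^{\mathbf{r}}_\sigma(t)(\mathbf{z}^{\mathbf{r}}_\sigma(t))^T]$ if $w=\sigma v\in L$; and $E[\mathbf{z}^{\mathbf{r}}_\sigma(t)(\mathbf{z}^{\mathbf{r}}_\sigma(t))^T]$ is nonsingular for all $\sigma\in\Sigma$. Standing assumptions: $\boldsymbol{\mu}$ is admissible; $\mathbf{u}$ is a white noise w.r.t. $\boldsymbol{\mu}$; $[\mathbf{y}^T,\mathbf{u}^T]^T$ is ZMWSSI. sGLSS. $\mathbf{S}=(\{A_\sigma,K_\sigma,B_\sigma\}_{\sigma=1}^{n_\mu},C,D,F,\mathbf{v})$,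 with $A_i\in\mathbb{R}^{n_x\times n_x}$, $B_i\in\mathbb{R}^{n_x\times n_u}$, $K_i\in\mathbb{R}^{n_x\times n_n}$, $C\in\mathbb{R}^{n_y\times n_x}$, $D\in\mathbb{R}^{n_y\times n_u}$, $F\in\mathbb{R}^{n_y\times n_n}$ and $\mathbf{v}$ an $\mathbb{R}^{n_n}$-valued (noise) process, is a stationary GLSS (sGLSS) of $(\mathbf{y},\mathbf{u},\boldsymbol{\mu})$ if there is an $\mathbb{R}^{n_x}$-valued (state) process $\mathbf{x}$ with $$\mathbf{x}(t+1)=\sum_{i=1}^{n_\mu}(A_i\mathbf{x}(t)+B_i\mathbf{u}(t)+K_i\mathbf{v}(t))\boldsymbol{\mu}_i(t),\qquad \mathbf{y}(t)=C\mathbf{x}(t)+D\mathbf{u}(t)+F\mathbf{v}(t)$$ for all $t\in\mathbb{Z}$, and: (1) $\boldsymbol{\omega}=[\mathbf{v}^T,\mathbf{u}^T]^T$ is a white noise w.r.t. $\boldsymbol{\mu}$, and $E[\mathbf{v}(t)\mathbf{u}(t)^T\boldsymbol{\mu}_\sigma^2(t)]=0$ for all $\sigma\in\Sigma$; (2) $[\mathbf{x}^T,\boldsymbol{\omega}^T]^T$ is ZMWSSI, and $E[\mathbf{z}^{\mathbf{x}}_\sigma(t)(\mathbf{z}^{\boldsymbol{\omega}}_\sigma(t))^T]=0$, $E[\mathbf{z}^{\mathbf{x}}_w(t)\boldsymbol{\omega}(t)^T]=0$ for all $\sigma\in\Sigma$, $w\in\Sigma^+$; (3) all eigenvalues of $\sum_{\sigma}p_\sigma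 A_\sigma\otimes A_\sigma$ lie in the open unit disc; (4) if $(\sigma_1,\sigma_2)\notin\mathcal{E}$ then $A_{\sigma_2}A_{\sigma_1}=0$ and $A_{\sigma_2}[K_{\sigma_1},B_{\sigma_1}]E[\mathbf{z}^{\boldsymbol{\omega}}_{\sigma_1}(t)(\mathbf{z}^{\boldsymbol{\omega}}_{\sigma_1}(t))^T]=0$. asGLSS (autonomous case). A tuple $(\{A_\sigma,K_\sigma\}_{\sigma=1}^{n_\mu},C,F,\mathbf{v})$ is an asGLSS of $(\mathbf{y},\boldsymbol{\mu})$ (for a given output process $\mathbf{y}$) if there is a process $\mathbf{x}$ with $\mathbf{x}(t+1)=\sum_i(A_i\mathbf{x}(t)+K_i\mathbf{v}(t))\boldsymbol{\mu}_i(t)$, $\mathbf{y}(t)=C\mathbf{x}(t)+F\mathbf{v}(t)$ for all $t$, and (1)–(4) above hold with the input removed, i.e. with $\boldsymbol{\omega}=\mathbf{v}$ and $[K_{\sigma_1},B_{\sigma_1}]$ replaced by $K_{\sigma_1}$. The state process $\mathbf{x}$ is uniquely determined by the tuple and $\boldsymbol{\mu}$. Reachability and observability of an asGLSS $(\{A_\sigma,K_\sigma\}_{\sigma=1}^{n_\mu},C,F,\mathbf{v})$ with state process $\mathbf{x}$ and dimension $n_x$: let $P_\sigma=E[\mathbf{x}(t)\mathbf{x}(t)^T\boldsymbol{\mu}_\sigma^2(t)]$, $Q_\sigma=E[\mathbf{v}(t)\mathbf{v}(t)^T\boldsymbol{\mu}_\sigma^2(t)]$ (independent of $t$) and $G_\sigma=\frac{1}{\sqrt{p_\sigma}}(A_\sigma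 P_\sigma C^T+K_\sigma Q_\sigma F^T)$. It is reachable if the columns of the matrices $A_wG_\sigma$, $w\in\Sigma^*$, $\sigma\in\Sigma$, span $\mathbb{R}^{n_x}$; it is observable if $\bigcap_{w\in\Sigma^*}\ker(CA_w)=\{0\}$. Projection. $\mathcal{H}_1$ is the Hilbert space of real square integrable random variables with $\langle \mathbf{a},\mathbf{b}\rangle=E[\mathbf{a}\mathbf{b}]$. For a square integrable random vector $\mathbf{z}$ and closed subspace $M\subseteq\mathcal{H}_1$, $E_l[\mathbf{z}\mid M]$ is the componentwise orthogonal projection onto $M$; for a set $\mathfrak{S}$ of square integrable random vectors, $E_l[\mathbf{z}\mid\mathfrak{S}]$ is the projection onto the closed subspace generated by the coordinates of the elements of $\mathfrak{S}$. Components of the output: $\mathbf{y}^d(t)=E_l[\mathbf{y}(t)\mid\{\mathbf{z}^{\mathbf{u}}_w(t)\}_{w\in\Sigma^+}\cup\{\mathbf{u}(t)\}]$ and $\mathbf{y}^s(t)=\mathbf{y}(t)-\mathbf{y}^d(t)$. Innovation process of $\mathbf{y}^s$: $\mathbf{e}^s(t)=\mathbf{y}^s(t)-E_l[\mathbf{y}^s(t)\mid\{\mathbf{z}^{\mathbf{y}^s}_w(t)\}_{w\in\Sigma^+}]$. A sGLSS $(\{A_\sigma,K_\sigma,B_\sigma\},C,D,F,\mathbf{v})$ of $(\mathbf{y},\mathbf{u},\boldsymbol{\mu})$ is in innovation form if $F$ is the identity matrix and $\mathbf{v}=\mathbf{e}^s$. *)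

theory Defs
  imports "HOL-Probability.Probability"
begin

text \<open>
  Processes are indexed by \<^typ>\<open>int\<close> and live on a probability space \<^term>\<open>M\<close>. The alphabet
  $\Sigma$ is a finite type \<open>'s\<close>, words are lists, the leftmost letter being the head.
  Random variables are only considered up to null sets: every equation between random variables
  is read almost surely.
\<close>

type_synonym ('w, 'a) process = "int \<Rightarrow> 'w \<Rightarrow> real ^ 'a"


subsection \<open>Block vectors and matrices\<close>

text \<open>With \<open>'a\<close> a type of rows, \<open>vstack\<close> also stacks two matrices on top of each other.\<close>

definition vstack :: "'a ^ 'm \<Rightarrow> 'a ^ 'n \<Rightarrow> 'a ^ ('m + 'n)" where
  "vstack x y = (\<chi> i. case i of Inl j \<Rightarrow> x $ j | Inr j \<Rightarrow> y $ j)"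

definition hstack :: "'a ^ 'm ^ 'k \<Rightarrow> 'a ^ 'n ^ 'k \<Rightarrow> 'a ^ ('m + 'n) ^ 'k" where
  "hstack A B = (\<chi> i. vstack (A $ i) (B $ i))"

definition pstack ::
  "('w, 'a::finite) process \<Rightarrow> ('w, 'b::finite) process \<Rightarrow> ('w, 'a + 'b) process" where
  "pstack X Y = (\<lambda>t \<omega>. vstack (X t \<omega>) (Y t \<omega>))"

definition outer :: "real ^ 'a \<Rightarrow> real ^ 'b \<Rightarrow> real ^ 'b ^ 'a" where
  "outer x y = (\<chi> i j. x $ i * y $ j)"

definition kronecker ::
  "real ^ 'n ^ 'm \<Rightarrow> real ^ 'l ^ 'k \<Rightarrow> real ^ ('n \<times> 'l) ^ ('m \<times> 'k)" where
  "kronecker A B = (\<chi> i j. A $ fst i $ fst j * B $ snd i $ snd j)"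

definition complex_eigenvalue :: "real ^ 'n ^ 'n \<Rightarrow> complex \<Rightarrow> bool" where
  "complex_eigenvalue A l \<longleftrightarrow>
     (\<exists>x :: complex ^ 'n. x \<noteq> 0 \<and> map_matrix complex_of_real A *v x = l *s x)"

fun word_mat :: "('s \<Rightarrow> real ^ 'n ^ 'n) \<Rightarrow> 's list \<Rightarrow> real ^ 'n ^ 'n" where
  "word_mat A [] = mat 1"
| "word_mat A (\<sigma> # w) = word_mat A w ** A \<sigma>"


subsection \<open>Generated \<open>\<sigma>\<close>-algebras, conditional independence, stationarity\<close>

definition gen_sigma :: "'w measure \<Rightarrow> ('w \<Rightarrow> 'b :: topological_space) set \<Rightarrow> 'w measure" where
  "gen_sigma M S = sigma (space M) {X -` B \<inter> space M | X B. X \<in> S \<and> B \<in> sets borel}"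

definition cond_indep :: "'w measure \<Rightarrow> 'w measure \<Rightarrow> 'w measure \<Rightarrow> 'w measure \<Rightarrow> bool" where
  "cond_indep M G F1 F2 \<longleftrightarrow>
     (\<forall>A \<in> sets F1. \<forall>B \<in> sets F2. AE \<omega> in M.
        real_cond_exp M G (indicator (A \<inter> B)) \<omega>
          = real_cond_exp M G (indicator A) \<omega> * real_cond_exp M G (indicator B) \<omega>)"

definition sq_integrable :: "'w measure \<Rightarrow> ('w \<Rightarrow> real) \<Rightarrow> bool" where
  "sq_integrable M f \<longleftrightarrow> f \<in> borel_measurable M \<and> integrable M (\<lambda>\<omega>. (f \<omega>)\<^sup>2)"

definition cross_moment ::
  "'w measure \<Rightarrow> ('w \<Rightarrow> real ^ 'a) \<Rightarrow> ('w \<Rightarrow> real ^ 'b) \<Rightarrow> real ^ 'b ^ 'a" where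
  "cross_moment M X Y = (LINT \<omega>|M. outer (X \<omega>) (Y \<omega>))"

definition jointly_wss :: "'w measure \<Rightarrow> ('w, 'a::finite) process set \<Rightarrow> bool" where
  "jointly_wss M S \<longleftrightarrow>
     (\<forall>X\<in>S. \<forall>t i. sq_integrable M (\<lambda>\<omega>. X t \<omega> $ i)) \<and>
     (\<forall>X\<in>S. \<forall>s t. (LINT \<omega>|M. X s \<omega>) = (LINT \<omega>|M. X t \<omega>)) \<and>
     (\<forall>X\<in>S. \<forall>Y\<in>S. \<forall>s t h.
        cross_moment M (X (s + h)) (Y (t + h)) = cross_moment M (X s) (Y t))"


subsection \<open>Admissible switching\<close>

definition mu_word :: "('w, 's::finite) process \<Rightarrow> 's list \<Rightarrow> int \<Rightarrow> 'w \<Rightarrow> real" where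
  "mu_word mu w t \<omega> = (\<Prod>i<length w. mu (t - int (length w) + 1 + int i) \<omega> $ (w ! i))"

definition adm_words :: "('s \<times> 's) set \<Rightarrow> 's list set" where
  "adm_words E = {w. w \<noteq> [] \<and> successively (\<lambda>\<sigma> \<sigma>'. (\<sigma>, \<sigma>') \<in> E) w}"

text \<open>The edge set \<open>E\<close> and the numbers \<open>p\<close>, whose existence admissibility postulates, are arguments
  because later notions depend on them.\<close>

definition admissible ::
  "'w measure \<Rightarrow> ('w, 's::finite) process \<Rightarrow> ('s \<times> 's) set \<Rightarrow> ('s \<Rightarrow> real) \<Rightarrow> bool" where
  "admissible M mu E p \<longleftrightarrow>
     (\<forall>t. mu t \<in> borel_measurable M) \<and>
     (\<forall>\<sigma>. \<exists>\<sigma>'. (\<sigma>, \<sigma>') \<in> E) \<and>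
     (\<forall>w. w \<noteq> [] \<and> w \<notin> adm_words E \<longrightarrow> (\<forall>t. AE \<omega> in M. mu_word mu w t \<omega> = 0)) \<and>
     (\<forall>\<sigma>. p \<sigma> > 0) \<and>
     (\<forall>w v \<sigma> \<sigma>' t. w \<noteq> [] \<and> v \<noteq> [] \<longrightarrow>
        (AE \<omega> in M. real_cond_exp M (gen_sigma M {mu k | k. k < t})
             (\<lambda>\<omega>. mu_word mu (w @ [\<sigma>]) t \<omega> * mu_word mu (v @ [\<sigma>']) t \<omega>) \<omega>
           = (if \<sigma> = \<sigma>' \<and> w @ [\<sigma>] \<in> adm_words E \<and> v @ [\<sigma>] \<in> adm_words E
              then p \<sigma> * mu_word mu w (t - 1) \<omega> * mu_word mu v (t - 1) \<omega> else 0))) \<and>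
     (\<forall>w \<sigma> \<sigma>' t. w \<noteq> [] \<longrightarrow>
        (AE \<omega> in M. real_cond_exp M (gen_sigma M {mu k | k. k < t})
             (\<lambda>\<omega>. mu_word mu (w @ [\<sigma>]) t \<omega> * mu t \<omega> $ \<sigma>') \<omega>
           = (if \<sigma> = \<sigma>' \<and> w @ [\<sigma>] \<in> adm_words E
              then p \<sigma> * mu_word mu w (t - 1) \<omega> else 0))) \<and>
     (\<forall>\<sigma> \<sigma>' t. \<sigma> \<noteq> \<sigma>' \<longrightarrow>
        (AE \<omega> in M. real_cond_exp M (gen_sigma M {mu k | k. k < t})
             (\<lambda>\<omega>. mu t \<omega> $ \<sigma> * mu t \<omega> $ \<sigma>') \<omega> = 0)) \<and>
     (\<exists>\<alpha> :: 's \<Rightarrow> real. \<forall>t. AE \<omega> in M. (\<Sum>\<sigma>\<in>UNIV. \<alpha> \<sigma> * mu t \<omega> $ \<sigma>) = 1) \<and>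
     (\<forall>w v. w \<noteq> [] \<and> v \<noteq> [] \<longrightarrow>
        jointly_wss M {\<lambda>t \<omega>. vector [mu_word mu w t \<omega>, mu_word mu v t \<omega>] :: real ^ 2})"

definition p_word :: "('s \<Rightarrow> real) \<Rightarrow> 's list \<Rightarrow> real" where
  "p_word p w = prod_list (map p w)"

definition z_proc ::
  "('w, 's::finite) process \<Rightarrow> ('s \<Rightarrow> real) \<Rightarrow> ('w, 'a::finite) process \<Rightarrow> 's list
     \<Rightarrow> ('w, 'a) process" where
  "z_proc mu p r w = (\<lambda>t \<omega>.
     (mu_word mu w (t - 1) \<omega> / sqrt (p_word p w)) *\<^sub>R r (t - int (length w)) \<omega>)"

definition zmwssi ::
  "'w measure \<Rightarrow> ('w, 's::finite) process \<Rightarrow> ('s \<Rightarrow> real) \<Rightarrow> ('w, 'a::finite) process \<Rightarrow> bool" where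
  "zmwssi M mu p r \<longleftrightarrow>
     (\<forall>t. cond_indep M (gen_sigma M {\<lambda>\<omega>. mu k \<omega> $ \<sigma> | k \<sigma>. k < t})
            (gen_sigma M {r k | k. k \<le> t})
            (gen_sigma M {\<lambda>\<omega>. mu k \<omega> $ \<sigma> | k \<sigma>. k \<ge> t})) \<and>
     (let S = insert r {z_proc mu p r w | w. w \<noteq> []} in
        jointly_wss M S \<and> (\<forall>X\<in>S. \<forall>t. (LINT \<omega>|M. X t \<omega>) = 0))"

definition white_noise ::
  "'w measure \<Rightarrow> ('w, 's::finite) process \<Rightarrow> ('s \<times> 's) set \<Rightarrow> ('s \<Rightarrow> real)
     \<Rightarrow> ('w, 'a::finite) process \<Rightarrow> bool" where
  "white_noise M mu E p r \<longleftrightarrow>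
     zmwssi M mu p r \<and>
     (\<forall>w v \<sigma> t. w \<noteq> [] \<longrightarrow>
        (w \<noteq> \<sigma> # v \<longrightarrow>
           cross_moment M (z_proc mu p r w t) (z_proc mu p r (\<sigma> # v) t) = 0) \<and>
        (w = \<sigma> # v \<and> w \<in> adm_words E \<longrightarrow>
           cross_moment M (z_proc mu p r w t) (z_proc mu p r (\<sigma> # v) t)
             = cross_moment M (z_proc mu p r [\<sigma>] t) (z_proc mu p r [\<sigma>] t))) \<and>
     (\<forall>\<sigma> t. invertible (cross_moment M (z_proc mu p r [\<sigma>] t) (z_proc mu p r [\<sigma>] t)))"


subsection \<open>Stationary switched systems\<close>

definition mu_moment ::
  "'w measure \<Rightarrow> ('w, 's::finite) process \<Rightarrow> 's \<Rightarrow> int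
     \<Rightarrow> ('w, 'a::finite) process \<Rightarrow> ('w, 'b::finite) process \<Rightarrow> real ^ 'b ^ 'a" where
  "mu_moment M mu \<sigma> t X Y = (LINT \<omega>|M. (mu t \<omega> $ \<sigma>)\<^sup>2 *\<^sub>R outer (X t \<omega>) (Y t \<omega>))"

definition mean_square_stable :: "('s::finite \<Rightarrow> real) \<Rightarrow> ('s \<Rightarrow> real ^ 'n ^ 'n) \<Rightarrow> bool" where
  "mean_square_stable p A \<longleftrightarrow>
     (\<forall>l. complex_eigenvalue (\<Sum>\<sigma>\<in>UNIV. p \<sigma> *\<^sub>R kronecker (A \<sigma>) (A \<sigma>)) l \<longrightarrow> cmod l < 1)"

definition sGLSS ::
  "'w measure \<Rightarrow> ('w, 's::finite) process \<Rightarrow> ('s \<times> 's) set \<Rightarrow> ('s \<Rightarrow> real)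
     \<Rightarrow> ('w, 'y::finite) process \<Rightarrow> ('w, 'u::finite) process
     \<Rightarrow> ('s \<Rightarrow> real ^ 'n ^ 'n) \<Rightarrow> ('s \<Rightarrow> real ^ 'k ^ 'n) \<Rightarrow> ('s \<Rightarrow> real ^ 'u ^ 'n)
     \<Rightarrow> real ^ 'n ^ 'y \<Rightarrow> real ^ 'u ^ 'y \<Rightarrow> real ^ 'k ^ 'y \<Rightarrow> ('w, 'k::finite) process \<Rightarrow> bool" where
  "sGLSS M mu E p y u A K B C D F v \<longleftrightarrow>
     (\<exists>x :: ('w, 'n::finite) process. let om = pstack v u in
        (\<forall>t. AE \<omega> in M. x (t + 1) \<omega> =
           (\<Sum>i\<in>UNIV. mu t \<omega> $ i *\<^sub>R (A i *v x t \<omega> + B i *v u t \<omega> + K i *v v t \<omega>))) \<and>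
        (\<forall>t. AE \<omega> in M. y t \<omega> = C *v x t \<omega> + D *v u t \<omega> + F *v v t \<omega>) \<and>
        white_noise M mu E p om \<and>
        (\<forall>\<sigma> t. mu_moment M mu \<sigma> t v u = 0) \<and>
        zmwssi M mu p (pstack x om) \<and>
        (\<forall>\<sigma> t. cross_moment M (z_proc mu p x [\<sigma>] t) (z_proc mu p om [\<sigma>] t) = 0) \<and>
        (\<forall>w t. w \<noteq> [] \<longrightarrow> cross_moment M (z_proc mu p x w t) (om t) = 0) \<and>
        mean_square_stable p A \<and>
        (\<forall>\<sigma>1 \<sigma>2. (\<sigma>1, \<sigma>2) \<notin> E \<longrightarrow>
           A \<sigma>2 ** A \<sigma>1 = 0 \<and>
           (\<forall>t. A \<sigma>2 ** hstack (K \<sigma>1) (B \<sigma>1)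
                  ** cross_moment M (z_proc mu p om [\<sigma>1] t) (z_proc mu p om [\<sigma>1] t) = 0)))"

text \<open>\<open>asGLSS_state \<dots> x\<close>: the tuple is an asGLSS of \<open>(y, mu)\<close> with state process \<open>x\<close>.\<close>

definition asGLSS_state ::
  "'w measure \<Rightarrow> ('w, 's::finite) process \<Rightarrow> ('s \<times> 's) set \<Rightarrow> ('s \<Rightarrow> real)
     \<Rightarrow> ('w, 'y::finite) process
     \<Rightarrow> ('s \<Rightarrow> real ^ 'n ^ 'n) \<Rightarrow> ('s \<Rightarrow> real ^ 'k ^ 'n)
     \<Rightarrow> real ^ 'n ^ 'y \<Rightarrow> real ^ 'k ^ 'y \<Rightarrow> ('w, 'k::finite) process
     \<Rightarrow> ('w, 'n::finite) process \<Rightarrow> bool" where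
  "asGLSS_state M mu E p y A K C F v x \<longleftrightarrow>
        (\<forall>t. AE \<omega> in M. x (t + 1) \<omega> =
           (\<Sum>i\<in>UNIV. mu t \<omega> $ i *\<^sub>R (A i *v x t \<omega> + K i *v v t \<omega>))) \<and>
        (\<forall>t. AE \<omega> in M. y t \<omega> = C *v x t \<omega> + F *v v t \<omega>) \<and>
        white_noise M mu E p v \<and>
        zmwssi M mu p (pstack x v) \<and>
        (\<forall>\<sigma> t. cross_moment M (z_proc mu p x [\<sigma>] t) (z_proc mu p v [\<sigma>] t) = 0) \<and>
        (\<forall>w t. w \<noteq> [] \<longrightarrow> cross_moment M (z_proc mu p x w t) (v t) = 0) \<and>
        mean_square_stable p A \<and>
        (\<forall>\<sigma>1 \<sigma>2. (\<sigma>1, \<sigma>2) \<notin> E \<longrightarrow>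
           A \<sigma>2 ** A \<sigma>1 = 0 \<and>
           (\<forall>t. A \<sigma>2 ** K \<sigma>1
                  ** cross_moment M (z_proc mu p v [\<sigma>1] t) (z_proc mu p v [\<sigma>1] t) = 0))"

definition asGLSS ::
  "'w measure \<Rightarrow> ('w, 's::finite) process \<Rightarrow> ('s \<times> 's) set \<Rightarrow> ('s \<Rightarrow> real)
     \<Rightarrow> ('w, 'y::finite) process
     \<Rightarrow> ('s \<Rightarrow> real ^ 'n ^ 'n) \<Rightarrow> ('s \<Rightarrow> real ^ 'k ^ 'n)
     \<Rightarrow> real ^ 'n ^ 'y \<Rightarrow> real ^ 'k ^ 'y \<Rightarrow> ('w, 'k::finite) process \<Rightarrow> bool" where
  "asGLSS M mu E p y A K C F v \<longleftrightarrow>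
     (\<exists>x :: ('w, 'n::finite) process. asGLSS_state M mu E p y A K C F v x)"

text \<open>The moments $P_\sigma$ and $Q_\sigma$ do not depend on the time; they are taken at time \<open>0\<close>.\<close>

definition G_mat ::
  "'w measure \<Rightarrow> ('w, 's::finite) process \<Rightarrow> ('s \<Rightarrow> real)
     \<Rightarrow> ('s \<Rightarrow> real ^ 'n ^ 'n) \<Rightarrow> ('s \<Rightarrow> real ^ 'k ^ 'n)
     \<Rightarrow> real ^ 'n ^ 'y \<Rightarrow> real ^ 'k ^ 'y \<Rightarrow> ('w, 'k::finite) process
     \<Rightarrow> ('w, 'n::finite) process \<Rightarrow> 's \<Rightarrow> real ^ 'y ^ 'n" where
  "G_mat M mu p A K C F v x \<sigma> =
     (1 / sqrt (p \<sigma>)) *\<^sub>R (A \<sigma> ** mu_moment M mu \<sigma> 0 x x ** transpose C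
                        + K \<sigma> ** mu_moment M mu \<sigma> 0 v v ** transpose F)"

text \<open>The state process of an asGLSS is unique up to null sets, so the existential quantifier
  just names it.\<close>

definition reachable ::
  "'w measure \<Rightarrow> ('w, 's::finite) process \<Rightarrow> ('s \<times> 's) set \<Rightarrow> ('s \<Rightarrow> real)
     \<Rightarrow> ('w, 'y::finite) process
     \<Rightarrow> ('s \<Rightarrow> real ^ 'n ^ 'n) \<Rightarrow> ('s \<Rightarrow> real ^ 'k ^ 'n)
     \<Rightarrow> real ^ 'n ^ 'y \<Rightarrow> real ^ 'k ^ 'y \<Rightarrow> ('w, 'k::finite) process \<Rightarrow> bool" where
  "reachable M mu E p y A K C F v \<longleftrightarrow>
     (\<exists>x :: ('w, 'n::finite) process. asGLSS_state M mu E p y A K C F v x \<and>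
        span (\<Union>w \<sigma>. columns (word_mat A w ** G_mat M mu p A K C F v x \<sigma>)) = UNIV)"

definition observable :: "('s \<Rightarrow> real ^ 'n ^ 'n) \<Rightarrow> real ^ 'n ^ 'y \<Rightarrow> bool" where
  "observable A C \<longleftrightarrow> (\<Inter>w. {x. (C ** word_mat A w) *v x = 0}) = {0}"


subsection \<open>Linear projections and the components of the output\<close>

definition closed_span :: "'w measure \<Rightarrow> ('w \<Rightarrow> real) set \<Rightarrow> ('w \<Rightarrow> real) set" where
  "closed_span M S = {f. sq_integrable M f \<and>
     (\<forall>e>0. \<exists>G c. finite G \<and> G \<subseteq> S \<and> (LINT \<omega>|M. (f \<omega> - (\<Sum>g\<in>G. c g * g \<omega>))\<^sup>2) < e)}"

text \<open>\<open>is_lproj M S z q\<close>: the random vector \<open>q\<close> is a version of $E_l[z \mid S]$.\<close>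

definition is_lproj ::
  "'w measure \<Rightarrow> ('w \<Rightarrow> real ^ 'b) set \<Rightarrow> ('w \<Rightarrow> real ^ 'a) \<Rightarrow> ('w \<Rightarrow> real ^ 'a) \<Rightarrow> bool" where
  "is_lproj M S z q \<longleftrightarrow>
     (let H = closed_span M {\<lambda>\<omega>. X \<omega> $ j | X j. X \<in> S} in
        \<forall>i. (\<lambda>\<omega>. q \<omega> $ i) \<in> H \<and> (\<forall>h\<in>H. (LINT \<omega>|M. (z \<omega> $ i - q \<omega> $ i) * h \<omega>) = 0))"

text \<open>\<open>yd\<close> is a version of $y^d$.\<close>

definition is_det_component ::
  "'w measure \<Rightarrow> ('w, 's::finite) process \<Rightarrow> ('s \<Rightarrow> real) \<Rightarrow> ('w, 'u::finite) process
     \<Rightarrow> ('w, 'y::finite) process \<Rightarrow> ('w, 'y) process \<Rightarrow> bool" where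
  "is_det_component M mu p u y yd \<longleftrightarrow>
     (\<forall>t. is_lproj M ({z_proc mu p u w t | w. w \<noteq> []} \<union> {u t}) (y t) (yd t))"

text \<open>\<open>e\<close> is a version of the innovation process of \<open>r\<close>.\<close>

definition is_innovation ::
  "'w measure \<Rightarrow> ('w, 's::finite) process \<Rightarrow> ('s \<Rightarrow> real)
     \<Rightarrow> ('w, 'y::finite) process \<Rightarrow> ('w, 'y) process \<Rightarrow> bool" where
  "is_innovation M mu p r e \<longleftrightarrow>
     (\<forall>t. \<exists>q. is_lproj M {z_proc mu p r w t | w. w \<noteq> []} (r t) q \<and> e t = (\<lambda>\<omega>. r t \<omega> - q \<omega>))"

end

theory Submission
  imports Defs
begin

text \<open>
  Once a nonsingular \<open>T\<close> carries the autonomous system \<open>(A, K, C)\<close> to \<open>(A', K', C')\<close>, the range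
  inclusion takes care of the input: every column of \<open>B \<sigma>\<close> and the corresponding
  column of \<open>B' \<sigma>\<close> are \<open>K \<sigma> q\<close> and \<open>K' \<sigma> q\<close> for one and the same \<open>q\<close>, and \<open>T\<close> matches them too.

  The heart of the matter is therefore the uniqueness of a reachable and observable innovation
  representation of a given output \<open>y\<close> driven by a given noise \<open>v\<close>
  (\<open>asGLSS_isomorphism\<close>). Two families of covariances can be computed from any such
  representation with state \<open>x\<close>. For letters \<open>\<sigma>\<close>, words \<open>w\<close> and \<open>k = |w| + 1\<close>,
  \<^item> the covariance of \<open>C x(k)\<close> with $\mu_{\sigma w}(k-1)\, v(0)$ is a positive multiple of
    $C A_w K_\sigma Q_\sigma$ (\<open>output_noise_moment\<close>);
  \<^item> the covariance of \<open>C x(k)\<close> with $\mu_{\sigma w}(k-1)\, y(0)$ is a positive multiple of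
    $C A_w G_\sigma$ (\<open>output_output_moment\<close>).

  But \<open>C x(k) = y(k) - F v(k)\<close> only depends on \<open>y\<close> and \<open>v\<close>, so both families agree for the two
  systems. By the second one \<open>(A, G, C)\<close> and \<open>(A', G', C')\<close> are minimal realizations of the same
  input-output map on words, hence isomorphic by a unique \<open>T\<close> (\<open>realization_isomorphism\<close>). By the
  first one, since $Q_\sigma$ is nonsingular, $K_\sigma$ and $K'_\sigma$ have the same response
  under $C A_w$ and $C' A'_w$, so that observability forces $T K_\sigma = K'_\sigma$.

  The covariances are computed by peeling off the last letter of the word
  (\<open>state_moment_snoc\<close>). Inserting the state equation at time \<open>t\<close> produces products of two letters
  $\mu_i(t) \mu_\tau(t)$; conditional independence allows replacing such a product by its
  conditional expectation given the past of \<open>\<mu>\<close> (\<open>cond_indep_integral\<close>), which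
  vanishes for $i \neq \tau$ and is $p_\tau$ times the shorter word for $i = \tau$. One
  step is made per letter, so that the computation ends at a moment at time \<open>0\<close>, which is
  $A_\sigma P_\sigma$ or $K_\sigma Q_\sigma$.
\<close>

section \<open>Block vectors, columns and word products\<close>

lemma vstack_nth [simp]: "vstack x y $ Inl i = x $ i" "vstack x y $ Inr j = y $ j"
  by (simp_all add: vstack_def)

lemma sum_Plus_UNIV:
  fixes f :: "'a::finite + 'b::finite \<Rightarrow> 'c::comm_monoid_add"
  shows "(\<Sum>c\<in>UNIV. f c) = (\<Sum>a\<in>UNIV. f (Inl a)) + (\<Sum>b\<in>UNIV. f (Inr b))"
  unfolding UNIV_Plus_UNIV[symmetric] by (subst sum.Plus) simp_all

lemma matrix_mult_column: "(L ** G) $ i $ j = (L *v column j G) $ i"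
  by (simp add: matrix_matrix_mult_def matrix_vector_mult_def column_def)

lemma matrix_mult_transpose_nth: "(L ** transpose G) $ i $ j = (L *v (G $ j)) $ i"
  by (simp add: matrix_matrix_mult_def matrix_vector_mult_def transpose_def)

lemma hstack_mult: "L ** hstack X Y = hstack (L ** X) (L ** Y)"
  by (simp add: vec_eq_iff hstack_def vstack_def matrix_matrix_mult_def split: sum.split)

lemma hstack_mult_vstack: "hstack X Y *v vstack a b = X *v a + Y *v b"
  by (simp add: vec_eq_iff hstack_def matrix_vector_mult_def sum_Plus_UNIV)

lemma matrix_eq_columns: "X = Y \<longleftrightarrow> (\<forall>j. column j X = column j Y)"
  by (auto simp: vec_eq_iff column_def)

lemma column_mult: "column j (X ** Y) = X *v column j Y"
  by (simp add: vec_eq_iff column_def matrix_matrix_mult_def matrix_vector_mult_def)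

lemma invertible_mult_right_cancel:
  fixes Q :: "real ^ 'k::finite ^ 'k"
  assumes "invertible Q" "X ** Q = Y ** Q"
  shows "X = Y"
proof -
  obtain R where "Q ** R = mat 1"
    using assms(1) unfolding invertible_def by auto
  then have "X = X ** Q ** R" "Y = Y ** Q ** R"
    by (simp_all flip: matrix_mul_assoc)
  then show ?thesis
    using assms(2) by simp
qed

lemma matrix_inv_works:
  assumes "invertible T"
  shows "T ** matrix_inv T = mat 1" "matrix_inv T ** T = mat 1"
  using assms someI_ex[of "\<lambda>T'. T ** T' = mat 1 \<and> T' ** T = mat 1"]
  unfolding invertible_def matrix_inv_def by auto

lemma vstack_mult: "vstack X Y *v z = vstack (X *v z) (Y *v z)"
  by (simp add: vec_eq_iff vstack_def matrix_vector_mult_def split: sum.split)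

lemma vstack_eq_iff: "vstack a b = vstack c d \<longleftrightarrow> a = c \<and> b = d"
proof
  assume eq: "vstack a b = vstack c d"
  then have "vstack a b $ Inl i = vstack c d $ Inl i" "vstack a b $ Inr j = vstack c d $ Inr j" for i j
    by simp_all
  then show "a = c \<and> b = d"
    by (simp add: vec_eq_iff)
qed simp

lemma word_mat_append: "word_mat A (v @ w) = word_mat A w ** word_mat A v"
  by (induction v) (simp_all add: matrix_mul_assoc)

lemma word_mat_snoc: "word_mat A (w @ [\<tau>]) = A \<tau> ** word_mat A w"
  by (simp add: word_mat_append)

text \<open>An inadmissible word breaks the edge relation at some pair of consecutive letters, where the
  corresponding product of matrices vanishes.\<close>

lemma word_mat_inadmissible:
  assumes "\<not> successively (\<lambda>\<sigma> \<tau>. (\<sigma>, \<tau>) \<in> E) (\<sigma> # w)"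
    and "\<And>\<sigma> \<tau>. (\<sigma>, \<tau>) \<notin> E \<Longrightarrow> A \<tau> ** A \<sigma> = 0 \<and> A \<tau> ** K \<sigma> = 0"
  shows "word_mat A w ** A \<sigma> = 0 \<and> word_mat A w ** K \<sigma> = 0"
  using assms(1)
proof (induction w arbitrary: \<sigma>)
  case (Cons \<tau> w)
  show ?case
  proof (cases "(\<sigma>, \<tau>) \<in> E")
    case True
    then have "word_mat A w ** A \<tau> = 0"
      using Cons by simp
    then show ?thesis by simp
  next
    case False
    then have "A \<tau> ** A \<sigma> = 0 \<and> A \<tau> ** K \<sigma> = 0"
      by (rule assms(2))
    then show ?thesis
      by (simp flip: matrix_mul_assoc)
  qed
qed simp

lemma reachable_columns:
  "(\<Union>w \<sigma>. columns (word_mat A w ** G \<sigma>)) = range (\<lambda>(w, (\<sigma>, j)). word_mat A w *v column j (G \<sigma>))"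
  (is "?L = range ?f")
proof -
  have "a \<in> range ?f" if "a \<in> ?L" for a
  proof -
    from that obtain w \<sigma> j where "a = word_mat A w *v column j (G \<sigma>)"
      by (auto simp: columns_def column_mult)
    then have "a = ?f (w, (\<sigma>, j))"
      by simp
    then show ?thesis
      by blast
  qed
  moreover have "?f i \<in> ?L" for i
    by (auto simp: columns_def column_mult split: prod.split)
  ultimately show ?thesis
    by blast
qed

section \<open>Uniqueness of reachable and observable realizations\<close>

lemma observableD:
  assumes "observable A C" and "\<And>w. (C ** word_mat A w) *v x = (C ** word_mat A w) *v y"
  shows "x = y"
proof -
  have "x - y \<in> (\<Inter>w. {x. (C ** word_mat A w) *v x = 0})"
    using assms(2) by (simp add: matrix_vector_mult_diff_distrib)
  then show ?thesis
    using assms(1) unfolding observable_def by simp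
qed

text \<open>Totality of a linear relation can be tested on a spanning set of first coordinates, because the
  first coordinates of a subspace form a subspace.\<close>

lemma span_UNIV_image_related:
  fixes R :: "('a::real_vector \<times> 'b::real_vector) set"
  assumes "subspace R" "S \<subseteq> R" "span (fst ` S) = UNIV"
  shows "\<exists>b. (a, b) \<in> R"
proof -
  have "span (fst ` S) \<subseteq> fst ` R"
    using assms(1,2) by (intro span_minimal image_mono linear_subspace_image) (auto simp: linear_fst)
  then show ?thesis
    using assms(3) by force
qed

text \<open>The relation \<open>R\<close> of having equal output responses is a subspace, invariant under the pairs
  \<open>(A \<sigma>, A' \<sigma>)\<close>. It contains all pairs \<open>(A_w g, A'_w g')\<close>, so reachability makes it total on both
  sides, while observability makes it single-valued in both directions: it is the graph of \<open>T\<close>.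
  The second conclusion says that \<open>T\<close> identifies any two vectors with equal responses, not only those
  generated by \<open>g\<close> and \<open>g'\<close>; this is what later identifies the noise gains.\<close>

lemma realization_isomorphism:
  fixes A :: "'s \<Rightarrow> real ^ 'n::finite ^ 'n" and C :: "real ^ 'n ^ 'y::finite" and g :: "'i \<Rightarrow> real ^ 'n"
    and A' :: "'s \<Rightarrow> real ^ 'm::finite ^ 'm" and C' :: "real ^ 'm ^ 'y" and g' :: "'i \<Rightarrow> real ^ 'm"
  assumes same: "\<And>w i. (C ** word_mat A w) *v g i = (C' ** word_mat A' w) *v g' i"
    and reach: "span (range (\<lambda>(w, i). word_mat A w *v g i)) = UNIV"
    and reach': "span (range (\<lambda>(w, i). word_mat A' w *v g' i)) = UNIV"
    and obs: "observable A C" and obs': "observable A' C'"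
  obtains T :: "real ^ 'n ^ 'm" where "invertible T"
    and "\<And>a b. (\<And>w. (C ** word_mat A w) *v a = (C' ** word_mat A' w) *v b) \<Longrightarrow> T *v a = b"
    and "\<And>\<sigma>. T ** A \<sigma> = A' \<sigma> ** T" and "C = C' ** T"
proof -
  define R where "R = {(a, b). \<forall>w. (C ** word_mat A w) *v a = (C' ** word_mat A' w) *v b}"
  define S where "S = range (\<lambda>(w, i). (word_mat A w *v g i, word_mat A' w *v g' i))"
  have sub: "subspace R"
    unfolding R_def subspace_def
    by (auto simp: matrix_vector_right_distrib matrix_vector_mult_scaleR zero_prod_def)
  have SR: "S \<subseteq> R"
  proof -
    have "(C ** word_mat A v) *v (word_mat A w *v g i)
        = (C' ** word_mat A' v) *v (word_mat A' w *v g' i)" for v w i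
      using same[of "w @ v" i]
      by (simp add: word_mat_append matrix_vector_mul_assoc matrix_mul_assoc)
    then show ?thesis
      unfolding S_def R_def by auto
  qed
  have left_total: "\<exists>b. (a, b) \<in> R" for a
  proof -
    have "fst ` S = range (\<lambda>(w, i). word_mat A w *v g i)"
      unfolding S_def image_image by (intro image_cong) auto
    then show ?thesis
      using span_UNIV_image_related[OF sub SR] reach by metis
  qed
  have right_total: "\<exists>a. (a, b) \<in> R" for b
  proof -
    define R' where "R' = prod.swap ` R"
    have "subspace R'"
      unfolding R'_def
      by (intro linear_subspace_image sub) (auto simp: linear_iff)
    moreover have "prod.swap ` S \<subseteq> R'"
      unfolding R'_def using SR by blast
    moreover have "fst ` prod.swap ` S = range (\<lambda>(w, i). word_mat A' w *v g' i)"
      unfolding S_def image_image by (intro image_cong) auto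
    ultimately have "\<exists>a. (b, a) \<in> R'"
      using span_UNIV_image_related[of R' "prod.swap ` S"] reach' by metis
    then show ?thesis
      unfolding R'_def by auto
  qed
  have right_unique: "b = b'" if "(a, b) \<in> R" "(a, b') \<in> R" for a b b'
    using that by (intro observableD[OF obs']) (auto simp: R_def)
  have left_unique: "a = a'" if "(a, b) \<in> R" "(a', b) \<in> R" for a a' b
    using that by (intro observableD[OF obs]) (auto simp: R_def)
  obtain f where f: "\<And>a. (a, f a) \<in> R"
    using left_total by metis
  obtain h where h: "\<And>b. (h b, b) \<in> R"
    using right_total by metis
  have "linear f"
    using subspace_add[OF sub f f] subspace_scale[OF sub f] f right_unique
    by (intro linearI) (simp_all, blast+)
  have "linear h"
    using subspace_add[OF sub h h] subspace_scale[OF sub h] h left_unique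
    by (intro linearI) (simp_all, blast+)
  define T where "T = matrix f"
  have T: "T *v a = f a" for a
    unfolding T_def using \<open>linear f\<close> by (simp add: matrix_works)
  have fh: "f (h b) = b" for b
    using f h right_unique by blast
  have hf: "h (f a) = a" for a
    using f h left_unique by blast
  have "invertible T"
    unfolding invertible_def
  proof (intro exI conjI)
    show "T ** matrix h = mat 1" "matrix h ** T = mat 1"
      using \<open>linear h\<close> fh hf
      by (simp_all add: matrix_eq T matrix_works flip: matrix_vector_mul_assoc)
  qed
  moreover have rel: "T *v a = b" if "\<And>w. (C ** word_mat A w) *v a = (C' ** word_mat A' w) *v b" for a b
    using that right_unique[OF f, of a b] by (simp add: T R_def)
  moreover have "T ** A \<sigma> = A' \<sigma> ** T" for \<sigma>
  proof -
    have "(C ** word_mat A w) *v (A \<sigma> *v a) = (C' ** word_mat A' w) *v (A' \<sigma> *v f a)" for w a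
    proof -
      have "(C ** word_mat A (\<sigma> # w)) *v a = (C' ** word_mat A' (\<sigma> # w)) *v f a"
        using f[of a] unfolding R_def by blast
      then show ?thesis
        by (simp add: matrix_vector_mul_assoc matrix_mul_assoc)
    qed
    then have "T *v (A \<sigma> *v a) = A' \<sigma> *v f a" for a
      by (intro rel)
    then show ?thesis
      by (simp add: matrix_eq T flip: matrix_vector_mul_assoc)
  qed
  moreover have "C = C' ** T"
  proof -
    have "(C ** word_mat A []) *v a = (C' ** word_mat A' []) *v f a" for a
      using f[of a] unfolding R_def by blast
    then show ?thesis
      by (simp add: matrix_eq T flip: matrix_vector_mul_assoc)
  qed
  ultimately show ?thesis
    using that by blast
qed

section \<open>Integration under conditional independence\<close>

text \<open>If \<open>H\<close> and \<open>G\<close> are conditionally independent given \<open>F\<close>, then conditioning on \<open>G\<close> together with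
  \<open>F\<close> tells nothing more about \<open>H\<close> than conditioning on \<open>F\<close>. Hence a factor \<open>Y Z\<close> built from \<open>G\<close> and
  \<open>F\<close> may be replaced by its conditional expectation given \<open>F\<close> when it is integrated against an
  \<open>H\<close>-measurable \<open>X\<close>. The definition of conditional independence speaks of events; the passage to
  functions is made one factor at a time. Each time a family of vanishing integrals over the events of a
  \<open>\<sigma>\<close>-algebra is read as a vanishing conditional expectation, which then integrates to zero
  against every measurable factor for which the product is integrable.\<close>

lemma (in prob_space) cond_indep_integral:
  fixes X Y Z :: "'a \<Rightarrow> real"
  assumes ci: "cond_indep M F H G"
    and sF: "subalgebra M F" and sH: "subalgebra M H" and sG: "subalgebra M G"
    and X: "X \<in> borel_measurable H" and Y: "Y \<in> borel_measurable G" and Z: "Z \<in> borel_measurable F"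
    and iY: "integrable M Y" and iYZ: "integrable M (\<lambda>x. Y x * Z x)"
    and iXYZ: "integrable M (\<lambda>x. X x * (Y x * Z x))"
    and iXE: "integrable M (\<lambda>x. X x * real_cond_exp M F (\<lambda>x. Y x * Z x) x)"
  shows "(LINT x|M. X x * (Y x * Z x)) = (LINT x|M. X x * real_cond_exp M F (\<lambda>x. Y x * Z x) x)"
proof -
  interpret F: finite_measure_subalgebra M F
    using sF by unfold_locales
  interpret G: finite_measure_subalgebra M G
    using sG by unfold_locales
  interpret H: finite_measure_subalgebra M H
    using sH by unfold_locales
  define W where "W = (\<lambda>x. Y x * Z x)"
  define V where "V = real_cond_exp M F W"
  have [measurable]: "Y \<in> borel_measurable M" "Z \<in> borel_measurable M" "X \<in> borel_measurable M"
    using measurable_from_subalg[OF sG Y] measurable_from_subalg[OF sF Z] measurable_from_subalg[OF sH X] .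
  have [measurable]: "W \<in> borel_measurable M" "V \<in> borel_measurable M" 
    unfolding W_def V_def by (auto simp: borel_measurable_cond_exp2)
  have iW: "integrable M W" and iV: "integrable M V"
    using iYZ F.real_cond_exp_int(1)[of W] by (simp_all add: W_def V_def)
  \<comment> \<open>The case where \<open>X\<close> is the indicator of an event \<open>a\<close> of \<open>H\<close>.\<close>
  have indicator_case: "(LINT x|M. indicator a x * W x) = (LINT x|M. indicator a x * V x)" if a: "a \<in> sets H" for a
  proof -
    have aM [measurable]: "a \<in> sets M"
      using a sH by (auto simp: subalgebra_def)
    define P where "P = real_cond_exp M F (indicator a)"
    have [measurable]: "P \<in> borel_measurable M" "P \<in> borel_measurable F"
      unfolding P_def by (auto simp: borel_measurable_cond_exp2)
    have ia: "integrable M (indicator a :: 'a \<Rightarrow> real)"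
      by (simp add: integrable_indicator_iff emeasure_eq_measure)
    have iP: "integrable M P"
      unfolding P_def by (rule F.real_cond_exp_int(1)[OF ia])
    have P01: "AE x in M. \<bar>P x\<bar> \<le> 1"
    proof -
      have "AE x in M. P x \<ge> 0"
        unfolding P_def using ia by (intro F.real_cond_exp_pos) auto
      moreover have "AE x in M. P x \<le> 1"
        unfolding P_def using ia
        by (intro F.real_cond_exp_le_c) (auto simp: indicator_def)
      ultimately show ?thesis by eventually_elim auto
    qed
    \<comment> \<open>The part of the event that \<open>F\<close> does not predict; it will turn out orthogonal to \<open>Y Z\<close>.\<close>
    define U where "U = (\<lambda>x. indicator a x - P x)"
    have [measurable]: "U \<in> borel_measurable M"
      unfolding U_def by measurable
    have U2: "AE x in M. \<bar>U x\<bar> \<le> 2"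
      using P01 by eventually_elim (auto simp: U_def indicator_def)
    have iU: "integrable M (\<lambda>x. f x * U x)" if "integrable M f" for f
    proof (rule Bochner_Integration.integrable_bound[OF integrable_mult_right[OF integrable_abs[OF that], of 2]])
      have [measurable]: "f \<in> borel_measurable M" using that by simp
      show "(\<lambda>x. f x * U x) \<in> borel_measurable M" by measurable
      show "AE x in M. norm (f x * U x) \<le> norm (2 * \<bar>f x\<bar>)"
        using U2 by eventually_elim (simp add: abs_mult mult.commute[of 2] mult_left_mono)
    qed
    \<comment> \<open>From events of \<open>G\<close> to the \<open>G\<close>-measurable factor \<open>Y\<close>, localized to an event \<open>c\<close> of \<open>F\<close>.\<close>
    have YU: "(LINT x|M. Y x * (indicator c x * U x)) = 0" if c: "c \<in> sets F" for c
    proof -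
      have [measurable]: "c \<in> sets M"
        using c sF by (auto simp: subalgebra_def)
      have ic: "integrable M (\<lambda>x. indicator c x * U x)"
        by (rule iU) (simp add: integrable_indicator_iff emeasure_eq_measure)
      have "(LINT x:b|M. indicator c x * U x) = (LINT x:b|M. 0)" if b: "b \<in> sets G" for b
      proof -
        have bM [measurable]: "b \<in> sets M"
          using b sG by (auto simp: subalgebra_def)
        have ind: "integrable M (indicator d :: 'a \<Rightarrow> real)" if "d \<in> sets M" for d
          using that by (simp add: integrable_indicator_iff emeasure_eq_measure)
        have bd: "integrable M (\<lambda>x. f x * P x)" if "f \<in> borel_measurable M" "\<And>x. \<bar>f x\<bar> \<le> 1" for f
        proof (rule Bochner_Integration.integrable_bound[OF iP])
          show "(\<lambda>x. f x * P x) \<in> borel_measurable M" using that by measurable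
          show "AE x in M. norm (f x * P x) \<le> norm (P x)"
            using that(2) by (simp add: abs_mult mult_left_le_one_le)
        qed
        have icab: "integrable M (\<lambda>x. indicator c x * indicator (a \<inter> b) x :: real)"
          using ind[of "c \<inter> (a \<inter> b)"] by (subst indicator_inter_arith[symmetric]) simp
        have "(LINT x|M. indicator c x * indicator (a \<inter> b) x)
            = (LINT x|M. indicator c x * real_cond_exp M F (indicator (a \<inter> b)) x)"
          by (rule F.real_cond_exp_intg(2)[OF icab, symmetric]) (use c in auto)
        also have "\<dots> = (LINT x|M. (indicator c x * P x) * real_cond_exp M F (indicator b) x)"
        proof (rule integral_cong_AE)
          have "AE x in M. real_cond_exp M F (indicator (a \<inter> b)) x = P x * real_cond_exp M F (indicator b) x"
            using ci a b unfolding cond_indep_def P_def by auto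
          then show "AE x in M. indicator c x * real_cond_exp M F (indicator (a \<inter> b)) x
              = indicator c x * P x * real_cond_exp M F (indicator b) x"
            by eventually_elim simp
        qed (auto simp: borel_measurable_cond_exp2)
        also have "\<dots> = (LINT x|M. (indicator c x * P x) * indicator b x)"
        proof (rule F.real_cond_exp_intg(2))
          have "integrable M (\<lambda>x. (indicator c x * indicator b x) * P x)"
            by (rule bd) (auto simp: indicator_def)
          then show "integrable M (\<lambda>x. indicator c x * P x * indicator b x)"
            by (simp add: mult_ac)
        qed (use c in auto)
        finally have eq: "(LINT x|M. indicator c x * indicator (a \<inter> b) x)
            = (LINT x|M. (indicator c x * P x) * indicator b x)" .
        have "(LINT x:b|M. indicator c x * U x)
            = (LINT x|M. indicator c x * indicator (a \<inter> b) x - (indicator c x * P x) * indicator b x)"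
          unfolding set_lebesgue_integral_def U_def
          by (intro Bochner_Integration.integral_cong) (auto simp: indicator_def)
        also have "\<dots> = 0"
        proof -
          have "integrable M (\<lambda>x. (indicator c x * indicator b x) * P x)"
            by (rule bd) (auto simp: indicator_def)
          then have "integrable M (\<lambda>x. indicator c x * P x * indicator b x)"
            by (simp add: mult_ac)
          with icab show ?thesis
            by (simp add: eq)
        qed
        finally show ?thesis
          by (simp add: set_lebesgue_integral_def)
      qed
      then have "AE x in M. real_cond_exp M G (\<lambda>x. indicator c x * U x) x = 0"
        using ic by (intro G.real_cond_exp_charact) auto
      then have "(LINT x|M. Y x * real_cond_exp M G (\<lambda>x. indicator c x * U x) x) = 0"
        by (intro integral_eq_zero_AE) (elim eventually_mono, simp)
      moreover have "integrable M (\<lambda>x. indicator c x * (Y x * U x))"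
        using integrable_mult_indicator[OF \<open>c \<in> sets M\<close> iU[OF iY]] by simp
      then have "integrable M (\<lambda>x. Y x * (indicator c x * U x))"
        by (simp add: mult_ac)
      ultimately show ?thesis
        using G.real_cond_exp_intg(2)[of Y "\<lambda>x. indicator c x * U x"] Y by simp
    qed
    \<comment> \<open>From events of \<open>F\<close> to the \<open>F\<close>-measurable factor \<open>Z\<close>.\<close>
    have "AE x in M. real_cond_exp M F (\<lambda>x. Y x * U x) x = 0"
    proof (rule F.real_cond_exp_charact)
      show "(LINT x:c|M. Y x * U x) = (LINT x:c|M. 0)" if "c \<in> sets F" for c
        using YU[OF that] by (simp add: set_lebesgue_integral_def mult_ac)
    qed (use iU[OF iY] in auto)
    then have "(LINT x|M. Z x * real_cond_exp M F (\<lambda>x. Y x * U x) x) = 0"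
      by (intro integral_eq_zero_AE) (elim eventually_mono, simp)
    moreover have iWU: "integrable M (\<lambda>x. W x * U x)"
      by (rule iU[OF iW])
    ultimately have WU: "(LINT x|M. W x * U x) = 0"
      using F.real_cond_exp_intg(2)[of Z "\<lambda>x. Y x * U x"] Z by (simp add: W_def mult_ac)
    have iaW: "integrable M (\<lambda>x. indicator a x * W x)" 
      using integrable_mult_indicator[OF aM iW] by simp
    have "integrable M (\<lambda>x. indicator a x * W x - W x * U x)"
      by (intro Bochner_Integration.integrable_diff iaW iWU)
    then have iPW: "integrable M (\<lambda>x. P x * W x)"
      by (simp add: U_def algebra_simps)
    have "(LINT x|M. indicator a x * W x) = (LINT x|M. P x * W x + W x * U x)"
      by (simp add: U_def algebra_simps)
    also have "\<dots> = (LINT x|M. P x * W x)"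
      using iPW iWU WU by simp
    also have "\<dots> = (LINT x|M. P x * V x)"
      unfolding V_def by (rule F.real_cond_exp_intg(2)[symmetric]) (use iPW in auto)
    also have "\<dots> = (LINT x|M. V x * P x)"
      by (simp add: mult.commute)
    also have "\<dots> = (LINT x|M. V x * indicator a x)"
      unfolding P_def
    proof (rule F.real_cond_exp_intg(2))
      show "integrable M (\<lambda>x. V x * indicator a x)"
        using integrable_mult_indicator[OF aM iV] by (simp add: mult.commute)
    qed (auto simp: V_def)
    finally show ?thesis by (simp add: mult.commute)
  qed
  \<comment> \<open>From events of \<open>H\<close> to the \<open>H\<close>-measurable factor \<open>X\<close>.\<close>
  have "AE x in M. real_cond_exp M H (\<lambda>x. W x - V x) x = 0"
  proof (rule H.real_cond_exp_charact)
    fix a assume a: "a \<in> sets H"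
    then have aM: "a \<in> sets M" using sH by (auto simp: subalgebra_def)
    show "(LINT x:a|M. W x - V x) = (LINT x:a|M. 0)"
      using indicator_case[OF a] integrable_mult_indicator[OF aM iW] integrable_mult_indicator[OF aM iV]
      by (simp add: set_lebesgue_integral_def right_diff_distrib)
  qed (use iW iV in auto)
  then have "(LINT x|M. X x * real_cond_exp M H (\<lambda>x. W x - V x) x) = 0"
    by (intro integral_eq_zero_AE) (elim eventually_mono, simp)
  moreover have "integrable M (\<lambda>x. X x * W x)" "integrable M (\<lambda>x. X x * V x)"
    using iXYZ iXE by (simp_all add: W_def V_def)
  ultimately have "(LINT x|M. X x * W x) = (LINT x|M. X x * V x)"
    using H.real_cond_exp_intg(2)[of X "\<lambda>x. W x - V x"] X
    by (simp add: right_diff_distrib)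
  then show ?thesis
    by (simp add: W_def V_def)
qed

section \<open>Generated \<open>\<sigma>\<close>-algebras and entries of moment matrices\<close>

lemma measurable_vec_iff:
  fixes f :: "'w \<Rightarrow> real ^ 'n::finite"
  shows "f \<in> borel_measurable N \<longleftrightarrow> (\<forall>i. (\<lambda>\<omega>. f \<omega> $ i) \<in> borel_measurable N)"
  unfolding borel_measurable_euclidean_space[of f]
  by (auto simp: Basis_vec_def inner_axis)

lemma space_gen_sigma [simp]: "space (gen_sigma M S) = space M"
  by (simp add: gen_sigma_def space_measure_of_conv)

lemma sets_gen_sigma:
  "sets (gen_sigma M S) = sigma_sets (space M) {X -` B \<inter> space M | X B. X \<in> S \<and> B \<in> sets borel}"
  unfolding gen_sigma_def by (rule sets_measure_of) auto

lemma measurable_gen_sigma: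
  assumes "X \<in> S"
  shows "X \<in> borel_measurable (gen_sigma M S)"
proof (rule measurableI)
  fix B :: "'b set" assume "B \<in> sets borel"
  then show "X -` B \<inter> space (gen_sigma M S) \<in> sets (gen_sigma M S)"
    using assms unfolding sets_gen_sigma by (auto intro!: sigma_sets.Basic)
qed simp

lemma sets_gen_sigma_subset:
  assumes "\<And>X. X \<in> S \<Longrightarrow> X \<in> borel_measurable N" "space N = space M"
  shows "sets (gen_sigma M S) \<subseteq> sets N"
proof -
  have "{X -` B \<inter> space M | X B. X \<in> S \<and> B \<in> sets borel} \<subseteq> sets N"
    using assms by (auto simp flip: assms(2) intro: measurable_sets)
  then show ?thesis
    using sets.sigma_sets_subset[of _ N] assms(2) by (simp add: sets_gen_sigma)
qed

lemma subalgebra_gen_sigma: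
  assumes "\<And>X. X \<in> S \<Longrightarrow> X \<in> borel_measurable M"
  shows "subalgebra M (gen_sigma M S)"
  unfolding subalgebra_def using sets_gen_sigma_subset[of S M M] assms by simp

text \<open>Admissibility conditions on the \<open>\<sigma>\<close>-algebra generated by the vectors \<open>\<mu>(k)\<close>, whereas conditional
  independence uses their components; the two must be identified before they can be combined.\<close>

lemma gen_sigma_components:
  fixes X :: "'k \<Rightarrow> 'w \<Rightarrow> real ^ 'n::finite"
  shows "gen_sigma M {\<lambda>\<omega>. X k \<omega> $ i | k i. k \<in> I} = gen_sigma M {X k | k. k \<in> I}"
    (is "gen_sigma M ?S = gen_sigma M ?V")
proof -
  have "sets (gen_sigma M ?S) \<subseteq> sets (gen_sigma M ?V)"
  proof (rule sets_gen_sigma_subset)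
    fix Y assume "Y \<in> ?S"
    then show "Y \<in> borel_measurable (gen_sigma M ?V)"
      using measurable_gen_sigma[of "X _" ?V M] by (auto simp: measurable_vec_iff)
  qed simp
  moreover have "sets (gen_sigma M ?V) \<subseteq> sets (gen_sigma M ?S)"
  proof (rule sets_gen_sigma_subset)
    fix Y assume "Y \<in> ?V"
    then obtain k where "Y = X k" "k \<in> I"
      by auto
    then show "Y \<in> borel_measurable (gen_sigma M ?S)"
      unfolding measurable_vec_iff by (auto intro!: measurable_gen_sigma)
  qed simp
  ultimately have "sets (gen_sigma M ?S) = sets (gen_sigma M ?V)"
    by blast
  then show ?thesis
    by (intro measure_eqI) (simp_all add: gen_sigma_def emeasure_sigma)
qed

lemma integrable_mult_sq_integrable:
  assumes "sq_integrable M f" "sq_integrable M g"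
  shows "integrable M (\<lambda>\<omega>. f \<omega> * g \<omega>)"
proof (rule Bochner_Integration.integrable_bound)
  show "integrable M (\<lambda>\<omega>. (f \<omega>)\<^sup>2 + (g \<omega>)\<^sup>2)"
    using assms by (auto simp: sq_integrable_def)
  show "(\<lambda>\<omega>. f \<omega> * g \<omega>) \<in> borel_measurable M"
    using assms by (auto simp: sq_integrable_def)
  have "\<bar>a * b\<bar> \<le> a\<^sup>2 + b\<^sup>2" for a b :: real
  proof -
    have "0 \<le> (\<bar>a\<bar> - \<bar>b\<bar>)\<^sup>2" by simp
    then have "2 * \<bar>a * b\<bar> \<le> a\<^sup>2 + b\<^sup>2"
      by (simp add: power2_diff abs_mult)
    then show ?thesis by simp
  qed
  then show "AE \<omega> in M. norm (f \<omega> * g \<omega>) \<le> norm ((f \<omega>)\<^sup>2 + (g \<omega>)\<^sup>2)"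
    by (simp add: abs_of_nonneg)
qed

lemma sq_integrable_cmult:
  "sq_integrable M f \<Longrightarrow> sq_integrable M (\<lambda>\<omega>. c * f \<omega>)"
  by (auto simp: sq_integrable_def power_mult_distrib intro!: borel_measurable_times)

lemma integral_matrix_nth:
  fixes f :: "'w \<Rightarrow> real ^ 'b::finite ^ 'a::finite"
  assumes "\<And>i j. integrable M (\<lambda>\<omega>. f \<omega> $ i $ j)"
  shows "(LINT \<omega>|M. f \<omega>) $ i $ j = (LINT \<omega>|M. f \<omega> $ i $ j)"
proof -
  have "integrable M (\<lambda>\<omega>. \<Sum>b\<in>Basis. (f \<omega> \<bullet> b) *\<^sub>R b)"
    using assms
    by (intro Bochner_Integration.integrable_sum integrable_scaleR_left)
      (auto simp: Basis_vec_def inner_axis)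
  then have "integrable M f"
    by (simp add: euclidean_representation)
  moreover have "bounded_linear (\<lambda>x :: real ^ 'b ^ 'a. x $ i $ j)"
    by (rule bounded_linear_compose[OF bounded_linear_vec_nth bounded_linear_vec_nth])
  ultimately show ?thesis
    by (rule integral_bounded_linear[symmetric, rotated])
qed

lemma outer_nth [simp]: "outer x y $ i $ j = x $ i * y $ j"
  by (simp add: outer_def)

lemma cross_moment_nth:
  assumes "\<And>i. sq_integrable M (\<lambda>\<omega>. X \<omega> $ i)" "\<And>j. sq_integrable M (\<lambda>\<omega>. Y \<omega> $ j)"
  shows "cross_moment M X Y $ i $ j = (LINT \<omega>|M. X \<omega> $ i * Y \<omega> $ j)"
proof -
  have "integrable M (\<lambda>\<omega>. outer (X \<omega>) (Y \<omega>) $ i $ j)" for i j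
    unfolding outer_nth by (rule integrable_mult_sq_integrable[OF assms])
  then show ?thesis
    unfolding cross_moment_def by (simp add: integral_matrix_nth)
qed

lemma mu_moment_nth:
  assumes "\<And>i. sq_integrable M (\<lambda>\<omega>. mu t \<omega> $ \<sigma> * X t \<omega> $ i)"
    and "\<And>j. sq_integrable M (\<lambda>\<omega>. mu t \<omega> $ \<sigma> * Y t \<omega> $ j)"
  shows "mu_moment M mu \<sigma> t X Y $ i $ j = (LINT \<omega>|M. (mu t \<omega> $ \<sigma> * X t \<omega> $ i) * (mu t \<omega> $ \<sigma> * Y t \<omega> $ j))"
proof -
  have eq: "((mu t \<omega> $ \<sigma>)\<^sup>2 *\<^sub>R outer (X t \<omega>) (Y t \<omega>)) $ i $ j
      = (mu t \<omega> $ \<sigma> * X t \<omega> $ i) * (mu t \<omega> $ \<sigma> * Y t \<omega> $ j)" for \<omega> i j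
    by (simp add: power2_eq_square)
  have "integrable M (\<lambda>\<omega>. ((mu t \<omega> $ \<sigma>)\<^sup>2 *\<^sub>R outer (X t \<omega>) (Y t \<omega>)) $ i $ j)" for i j
    unfolding eq by (rule integrable_mult_sq_integrable[OF assms])
  then show ?thesis
    unfolding mu_moment_def eq[symmetric] by (rule integral_matrix_nth)
qed

lemma pstack_nth [simp]: "pstack x y t \<omega> $ Inl i = x t \<omega> $ i" "pstack x y t \<omega> $ Inr j = y t \<omega> $ j"
  by (simp_all add: pstack_def)

section \<open>Moments of words of an admissible switching process\<close>

lemma mu_word_Nil [simp]: "mu_word mu [] t \<omega> = 1"
  by (simp add: mu_word_def)

lemma mu_word_snoc: "mu_word mu (w @ [\<sigma>]) t \<omega> = mu_word mu w (t - 1) \<omega> * mu t \<omega> $ \<sigma>"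
proof -
  have "mu_word mu (w @ [\<sigma>]) t \<omega>
      = (\<Prod>i<length w. mu (t - int (length w) + int i) \<omega> $ ((w @ [\<sigma>]) ! i)) * mu t \<omega> $ \<sigma>"
    by (simp add: mu_word_def)
  also have "(\<Prod>i<length w. mu (t - int (length w) + int i) \<omega> $ ((w @ [\<sigma>]) ! i)) = mu_word mu w (t - 1) \<omega>"
    unfolding mu_word_def by (intro prod.cong) (simp_all add: nth_append)
  finally show ?thesis .
qed

lemma mu_word_single [simp]: "mu_word mu [\<sigma>] t \<omega> = mu t \<omega> $ \<sigma>"
  using mu_word_snoc[of mu "[]" \<sigma> t \<omega>] by simp

lemma z_proc_nth:
  "z_proc mu p r w (t + 1) \<omega> $ i
     = (1 / sqrt (p_word p w)) * (mu_word mu w t \<omega> * r (t + 1 - int (length w)) \<omega> $ i)"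
  by (simp add: z_proc_def)

locale switching = prob_space M for M :: "'w measure" +
  fixes mu :: "('w, 's::finite) process" and E :: "('s \<times> 's) set" and p :: "'s \<Rightarrow> real"
  assumes adm: "admissible M mu E p"
begin

definition past :: "int \<Rightarrow> 'w measure" where
  "past t = gen_sigma M {mu k | k. k < t}"

lemma mu_measurable: "(\<lambda>\<omega>. mu t \<omega> $ \<sigma>) \<in> borel_measurable M"
  using adm[unfolded admissible_def, THEN conjunct1] by (simp add: measurable_vec_iff)

lemma mu_word_inadmissible:
  "w \<noteq> [] \<Longrightarrow> w \<notin> adm_words E \<Longrightarrow> AE \<omega> in M. mu_word mu w t \<omega> = 0"
  using adm[unfolded admissible_def, THEN conjunct2, THEN conjunct2, THEN conjunct1] by simp

lemma p_pos: "p \<sigma> > 0"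
  using adm unfolding admissible_def by (elim conjE) simp

lemma p_word_pos: "p_word p w > 0"
  by (induction w) (simp_all add: p_word_def p_pos)

lemma mu_word_sq_integrable:
  assumes "w \<noteq> []"
  shows "sq_integrable M (mu_word mu w t)"
proof -
  have "jointly_wss M {\<lambda>t \<omega>. vector [mu_word mu w t \<omega>, mu_word mu w t \<omega>] :: real ^ 2}"
    using adm assms unfolding admissible_def by (elim conjE) simp
  then have "\<forall>i. sq_integrable M (\<lambda>\<omega>. (vector [mu_word mu w t \<omega>, mu_word mu w t \<omega>] :: real ^ 2) $ i)"
    unfolding jointly_wss_def by simp
  from this[THEN spec, of 1] show ?thesis by simp
qed

lemma cond_exp_word_letter:
  assumes "w \<noteq> []"
  shows "AE \<omega> in M. real_cond_exp M (past t) (\<lambda>\<omega>. mu_word mu (w @ [\<sigma>]) t \<omega> * mu t \<omega> $ i) \<omega>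
     = (if \<sigma> = i \<and> w @ [\<sigma>] \<in> adm_words E then p \<sigma> * mu_word mu w (t - 1) \<omega> else 0)"
  using adm[unfolded admissible_def, THEN conjunct2, THEN conjunct2, THEN conjunct2, THEN conjunct2,
      THEN conjunct2, THEN conjunct1, rule_format, of w t \<sigma> i] assms
  unfolding past_def by simp

lemma cond_exp_two_letters:
  assumes "\<sigma> \<noteq> i"
  shows "AE \<omega> in M. real_cond_exp M (past t) (\<lambda>\<omega>. mu t \<omega> $ \<sigma> * mu t \<omega> $ i) \<omega> = 0"
  using adm[unfolded admissible_def, THEN conjunct2, THEN conjunct2, THEN conjunct2, THEN conjunct2,
      THEN conjunct2, THEN conjunct2, THEN conjunct1, rule_format, of \<sigma> i t] assms
  unfolding past_def by simp

lemma mu_measurable_past: "k < t \<Longrightarrow> (\<lambda>\<omega>. mu k \<omega> $ \<sigma>) \<in> borel_measurable (past t)"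
  using measurable_gen_sigma[of "mu k" "{mu k | k. k < t}" M]
  unfolding past_def by (auto simp: measurable_vec_iff)

lemma mu_word_measurable_past: "mu_word mu w (t - 1) \<in> borel_measurable (past t)"
  unfolding mu_word_def by (intro borel_measurable_prod mu_measurable_past) auto

lemma mu_word_measurable: "mu_word mu w t \<in> borel_measurable M"
  unfolding mu_word_def by (intro borel_measurable_prod mu_measurable)

lemma past_subalgebra: "subalgebra M (past t)"
  unfolding past_def by (rule subalgebra_gen_sigma) (auto simp: measurable_vec_iff mu_measurable)

context
  fixes r :: "('w, 'a::finite) process"
  assumes r: "zmwssi M mu p r"
begin

lemma zmwssi_sq_integrable: "sq_integrable M (\<lambda>\<omega>. r t \<omega> $ a)"
  using r unfolding zmwssi_def jointly_wss_def Let_def by (elim conjE) simp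

lemma zmwssi_z_sq_integrable:
  assumes "w \<noteq> []"
  shows "sq_integrable M (\<lambda>\<omega>. z_proc mu p r w t \<omega> $ a)"
proof -
  have "\<forall>X\<in>insert r {z_proc mu p r w | w. w \<noteq> []}. \<forall>t i. sq_integrable M (\<lambda>\<omega>. X t \<omega> $ i)"
    using r unfolding zmwssi_def jointly_wss_def Let_def by (elim conjE)
  then show ?thesis
    using assms by blast
qed

lemma zmwssi_word_sq_integrable:
  assumes "w \<noteq> []"
  shows "sq_integrable M (\<lambda>\<omega>. mu_word mu w t \<omega> * r (t + 1 - int (length w)) \<omega> $ a)"
proof -
  define c where "c = sqrt (p_word p w)"
  have "c \<noteq> 0"
    using p_word_pos[of w] by (simp add: c_def)
  have "sq_integrable M (\<lambda>\<omega>. (1 / c) * (mu_word mu w t \<omega> * r (t + 1 - int (length w)) \<omega> $ a))"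
    using zmwssi_z_sq_integrable[OF assms, of "t + 1" a] unfolding z_proc_nth c_def .
  then have "sq_integrable M (\<lambda>\<omega>. c * ((1 / c) * (mu_word mu w t \<omega> * r (t + 1 - int (length w)) \<omega> $ a)))"
    by (rule sq_integrable_cmult)
  then show ?thesis
    using \<open>c \<noteq> 0\<close> by simp
qed

lemma zmwssi_letter_sq_integrable: "sq_integrable M (\<lambda>\<omega>. mu t \<omega> $ \<sigma> * r t \<omega> $ a)"
  using zmwssi_word_sq_integrable[of "[\<sigma>]" t a] by simp

lemma zmwssi_word_letter_integrable:
  "integrable M (\<lambda>\<omega>. (mu t \<omega> $ i * r t \<omega> $ a) * (mu_word mu (w @ [\<sigma>]) t \<omega> * r (t - int (length w)) \<omega> $ b))"
  using zmwssi_word_sq_integrable[of "w @ [\<sigma>]" t b]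
  by (intro integrable_mult_sq_integrable zmwssi_letter_sq_integrable) simp

text \<open>At time \<open>t\<close> the values of \<open>r\<close> up to \<open>t\<close> are, given the past of \<open>\<mu>\<close>, independent of the two letters
  at time \<open>t\<close>, while the rest of the word is a function of the past of \<open>\<mu>\<close>. Grouping each letter or word with
  one value of \<open>r\<close> makes the integrand a product of two square integrable functions, which is where
  integrability comes from.\<close>

lemma integral_condition_on_past:
  assumes V: "AE \<omega> in M. real_cond_exp M (past t) (\<lambda>\<omega>. mu_word mu (w @ [\<sigma>]) t \<omega> * mu t \<omega> $ i) \<omega> = V \<omega>"
    and iV: "integrable M (\<lambda>\<omega>. (r t \<omega> $ a * r (t - int (length w)) \<omega> $ b) * V \<omega>)"
    and [measurable]: "V \<in> borel_measurable M"
  shows "(LINT \<omega>|M. (mu t \<omega> $ i * r t \<omega> $ a) * (mu_word mu (w @ [\<sigma>]) t \<omega> * r (t - int (length w)) \<omega> $ b))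
       = (LINT \<omega>|M. (r t \<omega> $ a * r (t - int (length w)) \<omega> $ b) * V \<omega>)"
proof -
  define H where "H = gen_sigma M {r k | k. k \<le> t}"
  define G where "G = gen_sigma M {\<lambda>\<omega>. mu k \<omega> $ \<sigma> | k \<sigma>. k \<ge> t}"
  define X where "X = (\<lambda>\<omega>. r t \<omega> $ a * r (t - int (length w)) \<omega> $ b)"
  define Y where "Y = (\<lambda>\<omega>. mu t \<omega> $ i * mu t \<omega> $ \<sigma>)"
  define Z where "Z = mu_word mu w (t - 1)"
  have r_measurable: "r k \<in> borel_measurable M" for k
    using zmwssi_sq_integrable[of k] by (auto simp: measurable_vec_iff sq_integrable_def)
  have YZ: "(\<lambda>\<omega>. mu_word mu (w @ [\<sigma>]) t \<omega> * mu t \<omega> $ i) = (\<lambda>\<omega>. Y \<omega> * Z \<omega>)"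
    by (auto simp: Y_def Z_def mu_word_snoc mult_ac)
  have XYZ: "(\<lambda>\<omega>. (mu t \<omega> $ i * r t \<omega> $ a) * (mu_word mu (w @ [\<sigma>]) t \<omega> * r (t - int (length w)) \<omega> $ b))
      = (\<lambda>\<omega>. X \<omega> * (Y \<omega> * Z \<omega>))"
    by (auto simp: X_def Y_def Z_def mu_word_snoc mult_ac)
  have past_eq: "gen_sigma M {\<lambda>\<omega>. mu k \<omega> $ \<sigma> | k \<sigma>. k < t} = past t"
    using gen_sigma_components[of M mu "{..<t}"] by (simp add: past_def)
  have "cond_indep M (past t) H G"
    using r unfolding zmwssi_def H_def G_def past_eq[symmetric] by simp
  moreover have sH: "subalgebra M H"
    unfolding H_def by (rule subalgebra_gen_sigma) (auto simp: r_measurable)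
  moreover have sG: "subalgebra M G"
    unfolding G_def by (rule subalgebra_gen_sigma) (auto simp: mu_measurable)
  moreover have "X \<in> borel_measurable H"
  proof -
    have "(\<lambda>\<omega>. r k \<omega> $ c) \<in> borel_measurable H" if "k \<le> t" for k c
      using that measurable_gen_sigma[of "r k" "{r k | k. k \<le> t}" M]
      unfolding H_def by (auto simp: measurable_vec_iff)
    then show ?thesis
      unfolding X_def by (intro borel_measurable_times) auto
  qed
  moreover have "Y \<in> borel_measurable G"
    unfolding Y_def G_def by (intro borel_measurable_times measurable_gen_sigma) auto
  moreover have "Z \<in> borel_measurable (past t)"
    unfolding Z_def by (rule mu_word_measurable_past)
  moreover have "integrable M Y"
    using mu_word_sq_integrable[of "[i]" t] mu_word_sq_integrable[of "[\<sigma>]" t]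
    unfolding Y_def by (intro integrable_mult_sq_integrable) (simp_all add: mu_word_single[abs_def])
  moreover have "integrable M (\<lambda>\<omega>. Y \<omega> * Z \<omega>)"
    using mu_word_sq_integrable[of "w @ [\<sigma>]" t] mu_word_sq_integrable[of "[i]" t]
    unfolding YZ[symmetric] by (intro integrable_mult_sq_integrable) (simp_all add: mu_word_single[abs_def])
  moreover have "integrable M (\<lambda>\<omega>. X \<omega> * (Y \<omega> * Z \<omega>))"
    using zmwssi_word_letter_integrable[of t i a w \<sigma> b] unfolding XYZ .
  moreover have V': "AE \<omega> in M. X \<omega> * real_cond_exp M (past t) (\<lambda>\<omega>. Y \<omega> * Z \<omega>) \<omega> = X \<omega> * V \<omega>"
    using V unfolding YZ by eventually_elim simp
  have [measurable]: "X \<in> borel_measurable M"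
    using r_measurable unfolding X_def by (intro borel_measurable_times) (simp_all add: measurable_vec_iff)
  have "integrable M (\<lambda>\<omega>. X \<omega> * real_cond_exp M (past t) (\<lambda>\<omega>. Y \<omega> * Z \<omega>) \<omega>)"
    using iV by (subst integrable_cong_AE[OF _ _ V']) (auto simp: borel_measurable_cond_exp2, simp add: X_def)
  ultimately have "(LINT \<omega>|M. X \<omega> * (Y \<omega> * Z \<omega>))
      = (LINT \<omega>|M. X \<omega> * real_cond_exp M (past t) (\<lambda>\<omega>. Y \<omega> * Z \<omega>) \<omega>)"
    using cond_indep_integral[of "past t" H G X Y Z] past_subalgebra by blast
  also have "\<dots> = (LINT \<omega>|M. X \<omega> * V \<omega>)"
    by (rule integral_cong_AE[OF _ _ V']) (auto simp: borel_measurable_cond_exp2)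
  finally show ?thesis
    unfolding XYZ by (simp add: X_def)
qed

lemma moment_last_letter:
  assumes "w \<noteq> []"
  shows "(LINT \<omega>|M. (mu t \<omega> $ i * r t \<omega> $ a) * (mu_word mu (w @ [\<sigma>]) t \<omega> * r (t - int (length w)) \<omega> $ b))
    = (if i = \<sigma> \<and> w @ [\<sigma>] \<in> adm_words E
       then p \<sigma> * (LINT \<omega>|M. r t \<omega> $ a * (mu_word mu w (t - 1) \<omega> * r (t - int (length w)) \<omega> $ b)) else 0)"
proof -
  define q where "q = (if \<sigma> = i \<and> w @ [\<sigma>] \<in> adm_words E then p \<sigma> else 0)"
  have int: "integrable M (\<lambda>\<omega>. r t \<omega> $ a * (mu_word mu w (t - 1) \<omega> * r (t - int (length w)) \<omega> $ b))"
    using zmwssi_word_sq_integrable[OF assms, of "t - 1" b]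
    by (intro integrable_mult_sq_integrable zmwssi_sq_integrable) simp
  have eq: "(r t \<omega> $ a * r (t - int (length w)) \<omega> $ b) * (q * mu_word mu w (t - 1) \<omega>)
      = q * (r t \<omega> $ a * (mu_word mu w (t - 1) \<omega> * r (t - int (length w)) \<omega> $ b))" for \<omega>
    by (simp add: mult_ac)
  have "(LINT \<omega>|M. (mu t \<omega> $ i * r t \<omega> $ a) * (mu_word mu (w @ [\<sigma>]) t \<omega> * r (t - int (length w)) \<omega> $ b))
      = (LINT \<omega>|M. (r t \<omega> $ a * r (t - int (length w)) \<omega> $ b) * (q * mu_word mu w (t - 1) \<omega>))"
  proof (rule integral_condition_on_past)
    show "AE \<omega> in M. real_cond_exp M (past t) (\<lambda>\<omega>. mu_word mu (w @ [\<sigma>]) t \<omega> * mu t \<omega> $ i) \<omega>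
        = q * mu_word mu w (t - 1) \<omega>"
      using cond_exp_word_letter[OF assms, of t \<sigma> i] by eventually_elim (auto simp: q_def)
  qed (use int mu_word_measurable in \<open>auto simp: eq\<close>)
  then show ?thesis
    unfolding eq by (auto simp: q_def)
qed

lemma moment_distinct_letters:
  assumes "i \<noteq> \<sigma>"
  shows "(LINT \<omega>|M. (mu t \<omega> $ i * r t \<omega> $ a) * (mu_word mu (w @ [\<sigma>]) t \<omega> * r (t - int (length w)) \<omega> $ b)) = 0"
proof (cases "w = []")
  case True
  have "(LINT \<omega>|M. (mu t \<omega> $ i * r t \<omega> $ a) * (mu_word mu ([] @ [\<sigma>]) t \<omega> * r (t - int (length ([] :: 's list))) \<omega> $ b))
      = (LINT \<omega>|M. (r t \<omega> $ a * r (t - int (length ([] :: 's list))) \<omega> $ b) * 0)"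
    using cond_exp_two_letters[of \<sigma> i t] assms
    by (intro integral_condition_on_past[where w = "[]" and V = "\<lambda>_. 0"]) auto
  then show ?thesis
    using True by simp
next
  case False
  then show ?thesis
    using assms by (simp add: moment_last_letter)
qed

end

end

section \<open>Covariances of one stationary system\<close>

locale switched_system = switching M mu E p
  for M :: "'w measure" and mu :: "('w, 's::finite) process" and E p +
  fixes y :: "('w, 'y::finite) process"
    and A :: "'s \<Rightarrow> real ^ 'n::finite ^ 'n" and K :: "'s \<Rightarrow> real ^ 'k::finite ^ 'n"
    and C :: "real ^ 'n ^ 'y" and F :: "real ^ 'k ^ 'y"
    and v :: "('w, 'k) process" and x :: "('w, 'n) process"
  assumes sys: "asGLSS_state M mu E p y A K C F v x"
begin

abbreviation r :: "('w, 'n + 'k) process" where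
  "r \<equiv> pstack x v"

abbreviation P :: "'s \<Rightarrow> real ^ 'n ^ 'n" where
  "P \<sigma> \<equiv> mu_moment M mu \<sigma> 0 x x"

abbreviation Q :: "'s \<Rightarrow> real ^ 'k ^ 'k" where
  "Q \<sigma> \<equiv> mu_moment M mu \<sigma> 0 v v"

lemma state_eq:
  "AE \<omega> in M. x (t + 1) \<omega> = (\<Sum>i\<in>UNIV. mu t \<omega> $ i *\<^sub>R (A i *v x t \<omega> + K i *v v t \<omega>))"
  using sys unfolding asGLSS_state_def by blast

lemma output_eq: "AE \<omega> in M. y t \<omega> = C *v x t \<omega> + F *v v t \<omega>"
  using sys unfolding asGLSS_state_def by blast

lemma zmwssi_r: "zmwssi M mu p r"
  using sys unfolding asGLSS_state_def by blast

lemma zmwssi_v: "zmwssi M mu p v"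
  using sys unfolding asGLSS_state_def white_noise_def by blast

lemmas r_sq_integrable = zmwssi_sq_integrable[OF zmwssi_r]
lemmas r_word_sq_integrable = zmwssi_word_sq_integrable[OF zmwssi_r]

lemma x_measurable: "(\<lambda>\<omega>. x t \<omega> $ a) \<in> borel_measurable M"
  using r_sq_integrable[of t "Inl a"] by (simp add: sq_integrable_def)

lemma v_measurable: "(\<lambda>\<omega>. v t \<omega> $ c) \<in> borel_measurable M"
  using r_sq_integrable[of t "Inr c"] by (simp add: sq_integrable_def)

lemma x_word_sq_integrable:
  "w \<noteq> [] \<Longrightarrow> sq_integrable M (\<lambda>\<omega>. mu_word mu w t \<omega> * x (t + 1 - int (length w)) \<omega> $ a)"
  using r_word_sq_integrable[of w t "Inl a"] by simp

lemma v_word_sq_integrable: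
  "w \<noteq> [] \<Longrightarrow> sq_integrable M (\<lambda>\<omega>. mu_word mu w t \<omega> * v (t + 1 - int (length w)) \<omega> $ a)"
  using r_word_sq_integrable[of w t "Inr a"] by simp

lemma z_sq_integrable:
  assumes "w \<noteq> []"
  shows "sq_integrable M (\<lambda>\<omega>. z_proc mu p x w t \<omega> $ a)"
    and "sq_integrable M (\<lambda>\<omega>. z_proc mu p v w t \<omega> $ c)"
  using zmwssi_z_sq_integrable[OF zmwssi_r assms, of t "Inl a"]
    zmwssi_z_sq_integrable[OF zmwssi_r assms, of t "Inr c"]
  by (simp_all add: z_proc_def)

lemma state_noise_uncorrelated:
  "(LINT \<omega>|M. (mu t \<omega> $ \<sigma> * v t \<omega> $ c) * (mu t \<omega> $ \<sigma> * x t \<omega> $ a)) = 0"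
proof -
  have "cross_moment M (z_proc mu p x [\<sigma>] (t + 1)) (z_proc mu p v [\<sigma>] (t + 1)) $ a $ c = 0"
    using sys unfolding asGLSS_state_def by simp
  then have "(LINT \<omega>|M. z_proc mu p x [\<sigma>] (t + 1) \<omega> $ a * z_proc mu p v [\<sigma>] (t + 1) \<omega> $ c) = 0"
    by (simp add: cross_moment_nth z_sq_integrable)
  then have "(LINT \<omega>|M. (1 / p \<sigma>) * ((mu t \<omega> $ \<sigma> * v t \<omega> $ c) * (mu t \<omega> $ \<sigma> * x t \<omega> $ a))) = 0"
    using p_pos[of \<sigma>] by (simp add: z_proc_nth p_word_def mult_ac)
  then show ?thesis
    using p_pos[of \<sigma>] by simp
qed

lemma noise_past_state_uncorrelated:
  assumes "w \<noteq> []"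
  shows "(LINT \<omega>|M. v t \<omega> $ c * (mu_word mu w (t - 1) \<omega> * x (t - int (length w)) \<omega> $ a)) = 0"
proof -
  have "cross_moment M (z_proc mu p x w t) (v t) $ a $ c = 0"
    using sys assms unfolding asGLSS_state_def by simp
  then have "(LINT \<omega>|M. z_proc mu p x w t \<omega> $ a * v t \<omega> $ c) = 0"
    using assms by (simp add: cross_moment_nth z_sq_integrable zmwssi_sq_integrable[OF zmwssi_v])
  then have "(LINT \<omega>|M. (1 / sqrt (p_word p w)) *
      (v t \<omega> $ c * (mu_word mu w (t - 1) \<omega> * x (t - int (length w)) \<omega> $ a))) = 0"
    by (simp add: z_proc_def mult_ac)
  then show ?thesis
    using p_word_pos[of w] by simp
qed

lemma noise_white:
  assumes "w \<noteq> []"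
  shows "(LINT \<omega>|M. (mu t \<omega> $ \<sigma> * v t \<omega> $ c)
      * (mu_word mu (w @ [\<sigma>]) t \<omega> * v (t - int (length w)) \<omega> $ d)) = 0"
proof -
  have wn: "white_noise M mu E p v"
    using sys unfolding asGLSS_state_def by blast
  have "cross_moment M (z_proc mu p v (w @ [\<sigma>]) (t + 1)) (z_proc mu p v ([\<sigma>]) (t + 1)) = 0"
    using wn assms unfolding white_noise_def by auto
  then have "cross_moment M (z_proc mu p v (w @ [\<sigma>]) (t + 1)) (z_proc mu p v ([\<sigma>]) (t + 1)) $ d $ c = 0"
    by simp
  then have "(LINT \<omega>|M. z_proc mu p v (w @ [\<sigma>]) (t + 1) \<omega> $ d * z_proc mu p v [\<sigma>] (t + 1) \<omega> $ c) = 0"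
    by (simp add: cross_moment_nth z_sq_integrable)
  then have "(LINT \<omega>|M. (1 / (sqrt (p_word p (w @ [\<sigma>])) * sqrt (p \<sigma>))) *
      ((mu t \<omega> $ \<sigma> * v t \<omega> $ c) * (mu_word mu (w @ [\<sigma>]) t \<omega> * v (t - int (length w)) \<omega> $ d))) = 0"
    by (simp add: z_proc_nth p_word_def mult_ac)
  then show ?thesis
    using p_word_pos[of "w @ [\<sigma>]"] p_pos[of \<sigma>] by simp
qed

text \<open>The vanishing of \<open>A \<tau> ** K \<sigma>\<close> is only postulated after multiplication by a noise covariance,
  which is nonsingular by whiteness.\<close>

lemma vanishing_products:
  assumes "(\<sigma>, \<tau>) \<notin> E"
  shows "A \<tau> ** A \<sigma> = 0 \<and> A \<tau> ** K \<sigma> = 0"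
proof
  show "A \<tau> ** A \<sigma> = 0"
    using sys assms unfolding asGLSS_state_def by blast
  define S where "S = cross_moment M (z_proc mu p v [\<sigma>] 1) (z_proc mu p v [\<sigma>] 1)"
  have "A \<tau> ** K \<sigma> ** S = 0"
    using sys assms unfolding asGLSS_state_def S_def by blast
  moreover have "invertible S"
    using sys unfolding asGLSS_state_def white_noise_def S_def by (elim conjE) simp
  then obtain S' where "S ** S' = mat 1"
    unfolding invertible_def by auto
  then have "A \<tau> ** K \<sigma> = A \<tau> ** K \<sigma> ** S ** S'"
    by (simp flip: matrix_mul_assoc)
  ultimately show "A \<tau> ** K \<sigma> = 0"
    by simp
qed

text \<open>The word is anchored so that its last letter sits right before time \<open>t\<close> and its first letter is
  simultaneous with \<open>r\<close>; thus \<open>w\<close> records the path by which \<open>r\<close> influences the state at time \<open>t\<close>.\<close>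

definition state_moment :: "'s list \<Rightarrow> int \<Rightarrow> 'n \<Rightarrow> 'n + 'k \<Rightarrow> real" where
  "state_moment w t a b = (LINT \<omega>|M. x t \<omega> $ a * (mu_word mu w (t - 1) \<omega> * r (t - int (length w)) \<omega> $ b))"

text \<open>Of the sum over all modes in the state equation, only the mode equal to the last letter of the
  word is correlated with it.\<close>

lemma state_moment_expand:
  "state_moment (w @ [\<sigma>]) (t + 1) a b =
     (\<Sum>c\<in>UNIV. A \<sigma> $ a $ c *
        (LINT \<omega>|M. (mu t \<omega> $ \<sigma> * x t \<omega> $ c) * (mu_word mu (w @ [\<sigma>]) t \<omega> * r (t - int (length w)) \<omega> $ b))) +
     (\<Sum>c\<in>UNIV. K \<sigma> $ a $ c *
        (LINT \<omega>|M. (mu t \<omega> $ \<sigma> * v t \<omega> $ c) * (mu_word mu (w @ [\<sigma>]) t \<omega> * r (t - int (length w)) \<omega> $ b)))"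
proof -
  define z where "z = (\<lambda>\<omega>. mu_word mu (w @ [\<sigma>]) t \<omega> * r (t - int (length w)) \<omega> $ b)"
  define H where "H i c = (case c of Inl c \<Rightarrow> A i $ a $ c | Inr c \<Rightarrow> K i $ a $ c)" for i c
  have [measurable]: "z \<in> borel_measurable M"
    using r_word_sq_integrable[of "w @ [\<sigma>]" t b] by (simp add: z_def sq_integrable_def)
  have [measurable]: "(\<lambda>\<omega>. mu t \<omega> $ i) \<in> borel_measurable M" "(\<lambda>\<omega>. r t \<omega> $ c) \<in> borel_measurable M" for i c
    using mu_measurable r_sq_integrable[of t c] by (simp_all add: sq_integrable_def)
  have int: "integrable M (\<lambda>\<omega>. (mu t \<omega> $ i * r t \<omega> $ c) * z \<omega>)" for i c
    unfolding z_def by (rule zmwssi_word_letter_integrable[OF zmwssi_r])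
  have "state_moment (w @ [\<sigma>]) (t + 1) a b = (LINT \<omega>|M. x (t + 1) \<omega> $ a * z \<omega>)"
    by (simp add: state_moment_def z_def)
  also have "\<dots> = (LINT \<omega>|M. (\<Sum>i\<in>UNIV. \<Sum>c\<in>UNIV. H i c * ((mu t \<omega> $ i * r t \<omega> $ c) * z \<omega>)))"
  proof (rule integral_cong_AE)
    show "AE \<omega> in M. x (t + 1) \<omega> $ a * z \<omega>
        = (\<Sum>i\<in>UNIV. \<Sum>c\<in>UNIV. H i c * ((mu t \<omega> $ i * r t \<omega> $ c) * z \<omega>))"
      using state_eq[of t]
    proof eventually_elim
      case (elim \<omega>)
      show ?case
        unfolding elim sum_Plus_UNIV
        by (simp add: H_def sum_component matrix_vector_mult_def sum_distrib_left sum_distrib_right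
            sum.distrib algebra_simps)
    qed
  qed (use x_measurable in measurable)
  also have "\<dots> = (\<Sum>i\<in>UNIV. \<Sum>c\<in>UNIV. H i c * (LINT \<omega>|M. (mu t \<omega> $ i * r t \<omega> $ c) * z \<omega>))"
    using int by (simp add: Bochner_Integration.integral_sum)
  also have "\<dots> = (\<Sum>i\<in>UNIV. if i = \<sigma> then \<Sum>c\<in>UNIV. H \<sigma> c * (LINT \<omega>|M. (mu t \<omega> $ \<sigma> * r t \<omega> $ c) * z \<omega>) else 0)"
    using moment_distinct_letters[OF zmwssi_r] unfolding z_def by (intro sum.cong) auto
  also have "\<dots> = (\<Sum>c\<in>UNIV. H \<sigma> c * (LINT \<omega>|M. (mu t \<omega> $ \<sigma> * r t \<omega> $ c) * z \<omega>))"
    by simp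
  finally show ?thesis
    unfolding sum_Plus_UNIV z_def by (simp add: H_def)
qed

text \<open>The new noise term drops out: it is uncorrelated with past states by assumption and with past
  noise by whiteness.\<close>

lemma state_moment_snoc:
  assumes "w \<noteq> []" and "w @ [\<sigma>] \<in> adm_words E"
  shows "state_moment (w @ [\<sigma>]) (t + 1) a b = p \<sigma> * (\<Sum>c\<in>UNIV. A \<sigma> $ a $ c * state_moment w t c b)"
proof -
  have "(LINT \<omega>|M. (mu t \<omega> $ \<sigma> * x t \<omega> $ c) * (mu_word mu (w @ [\<sigma>]) t \<omega> * r (t - int (length w)) \<omega> $ b))
      = p \<sigma> * state_moment w t c b" for c
    using moment_last_letter[OF zmwssi_r assms(1), of t \<sigma> "Inl c" \<sigma> b] assms(2)
    by (simp add: state_moment_def)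
  moreover have "(LINT \<omega>|M. (mu t \<omega> $ \<sigma> * v t \<omega> $ c) *
      (mu_word mu (w @ [\<sigma>]) t \<omega> * r (t - int (length w)) \<omega> $ b)) = 0" for c
  proof (cases b)
    case (Inl d)
    then show ?thesis
      using moment_last_letter[OF zmwssi_r assms(1), of t \<sigma> "Inr c" \<sigma> b]
        noise_past_state_uncorrelated[OF assms(1)] by simp
  next
    case (Inr d)
    then show ?thesis
      using noise_white[OF assms(1)] by simp
  qed
  ultimately show ?thesis
    unfolding state_moment_expand by (simp add: sum_distrib_left mult_ac)
qed

lemma state_moment_single:
  "state_moment [\<sigma>] 1 a b = hstack (A \<sigma> ** P \<sigma>) (K \<sigma> ** Q \<sigma>) $ a $ b"
proof -
  have x: "sq_integrable M (\<lambda>\<omega>. mu 0 \<omega> $ \<sigma> * x 0 \<omega> $ c)" for c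
    using x_word_sq_integrable[of "[\<sigma>]" 0 c] by simp
  have v: "sq_integrable M (\<lambda>\<omega>. mu 0 \<omega> $ \<sigma> * v 0 \<omega> $ c)" for c
    using v_word_sq_integrable[of "[\<sigma>]" 0 c] by simp
  have xv: "(LINT \<omega>|M. (mu 0 \<omega> $ \<sigma> * x 0 \<omega> $ c) * (mu 0 \<omega> $ \<sigma> * v 0 \<omega> $ d)) = 0" for c d
    using state_noise_uncorrelated[of 0 \<sigma> d c] by (simp add: mult_ac)
  have P: "(LINT \<omega>|M. (mu 0 \<omega> $ \<sigma> * x 0 \<omega> $ c) * (mu 0 \<omega> $ \<sigma> * x 0 \<omega> $ d)) = P \<sigma> $ c $ d" for c d
    by (rule mu_moment_nth[symmetric]) (rule x)+
  have Q: "(LINT \<omega>|M. (mu 0 \<omega> $ \<sigma> * v 0 \<omega> $ c) * (mu 0 \<omega> $ \<sigma> * v 0 \<omega> $ d)) = Q \<sigma> $ c $ d" for c d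
    by (rule mu_moment_nth[symmetric]) (rule v)+
  have expand: "state_moment [\<sigma>] 1 a b =
      (\<Sum>c\<in>UNIV. A \<sigma> $ a $ c * (LINT \<omega>|M. (mu 0 \<omega> $ \<sigma> * x 0 \<omega> $ c) * (mu 0 \<omega> $ \<sigma> * r 0 \<omega> $ b))) +
      (\<Sum>c\<in>UNIV. K \<sigma> $ a $ c * (LINT \<omega>|M. (mu 0 \<omega> $ \<sigma> * v 0 \<omega> $ c) * (mu 0 \<omega> $ \<sigma> * r 0 \<omega> $ b)))"
    using state_moment_expand[of "[]" \<sigma> 0 a b] by simp
  show ?thesis
  proof (cases b)
    case (Inl d)
    show ?thesis
      unfolding expand unfolding Inl pstack_nth P state_noise_uncorrelated
      by (simp add: hstack_def matrix_matrix_mult_def)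
  next
    case (Inr d)
    show ?thesis
      unfolding expand unfolding Inr pstack_nth Q xv
      by (simp add: hstack_def matrix_matrix_mult_def)
  qed
qed

text \<open>For inadmissible words the formula stays true because both sides vanish, the left one through
  the switching process and the right one through the matrices. So two
  systems can be compared word by word.\<close>

lemma state_moment_word:
  "state_moment (\<sigma> # w) (int (length w) + 1) a b
     = p_word p w * (word_mat A w ** hstack (A \<sigma> ** P \<sigma>) (K \<sigma> ** Q \<sigma>)) $ a $ b"
proof (cases "successively (\<lambda>\<sigma> \<tau>. (\<sigma>, \<tau>) \<in> E) (\<sigma> # w)")
  case True
  then show ?thesis
  proof (induction w arbitrary: a rule: rev_induct)
    case Nil
    show ?case
      by (simp add: state_moment_single p_word_def)
  next
    case (snoc \<tau> w)
    have "successively (\<lambda>\<sigma> \<tau>. (\<sigma>, \<tau>) \<in> E) ((\<sigma> # w) @ [\<tau>])"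
      using snoc.prems by simp
    then have s: "successively (\<lambda>\<sigma> \<tau>. (\<sigma>, \<tau>) \<in> E) (\<sigma> # w)"
      unfolding successively_append_iff by blast
    have "(\<sigma> # w) @ [\<tau>] \<in> adm_words E"
      using snoc.prems by (simp add: adm_words_def)
    from state_moment_snoc[OF _ this, of "int (length w) + 1" a b]
    have "state_moment (\<sigma> # w @ [\<tau>]) (int (length (w @ [\<tau>])) + 1) a b
        = p \<tau> * (\<Sum>c\<in>UNIV. A \<tau> $ a $ c * state_moment (\<sigma> # w) (int (length w) + 1) c b)"
      by (simp add: add_ac)
    also have "\<dots> = p \<tau> * (p_word p w *
        (A \<tau> ** (word_mat A w ** hstack (A \<sigma> ** P \<sigma>) (K \<sigma> ** Q \<sigma>))) $ a $ b)"
      by (simp add: snoc.IH[OF s] matrix_matrix_mult_def[of "A \<tau>"] sum_distrib_left mult_ac)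
    finally show ?case
      by (simp add: word_mat_snoc p_word_def matrix_mul_assoc)
  qed
next
  case False
  then have "\<sigma> # w \<notin> adm_words E"
    by (simp add: adm_words_def)
  then have "AE \<omega> in M. mu_word mu (\<sigma> # w) (int (length w)) \<omega> = 0"
    by (intro mu_word_inadmissible) auto
  then have "state_moment (\<sigma> # w) (int (length w) + 1) a b = 0"
    unfolding state_moment_def by (intro integral_eq_zero_AE) (elim eventually_mono, simp)
  moreover have "word_mat A w ** A \<sigma> = 0 \<and> word_mat A w ** K \<sigma> = 0"
    using False vanishing_products by (rule word_mat_inadmissible)
  then have "word_mat A w ** hstack (A \<sigma> ** P \<sigma>) (K \<sigma> ** Q \<sigma>) = 0"
    by (simp add: hstack_mult matrix_mul_assoc) (simp add: vec_eq_iff hstack_def vstack_def split: sum.split)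
  ultimately show ?thesis
    by simp
qed

text \<open>With a free linear functional \<open>l\<close> of \<open>(x(0), v(0))\<close>, one formula covers both the noise and the
  output at time \<open>0\<close>.\<close>

lemma output_moment:
  "(LINT \<omega>|M. (C *v x (int (length w) + 1) \<omega>) $ i * (mu_word mu (\<sigma> # w) (int (length w)) \<omega> * (l \<bullet> r 0 \<omega>)))
     = p_word p w * (C *v (word_mat A w *v (hstack (A \<sigma> ** P \<sigma>) (K \<sigma> ** Q \<sigma>) *v l))) $ i"
proof -
  let ?t = "int (length w) + 1"
  define N where "N = word_mat A w ** hstack (A \<sigma> ** P \<sigma>) (K \<sigma> ** Q \<sigma>)"
  have int: "integrable M (\<lambda>\<omega>. x ?t \<omega> $ a * (mu_word mu (\<sigma> # w) (int (length w)) \<omega> * r 0 \<omega> $ b))" for a b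
    using r_sq_integrable[of ?t "Inl a"] r_word_sq_integrable[of "\<sigma> # w" "int (length w)" b]
    by (intro integrable_mult_sq_integrable) simp_all
  have "(LINT \<omega>|M. (C *v x ?t \<omega>) $ i * (mu_word mu (\<sigma> # w) (int (length w)) \<omega> * (l \<bullet> r 0 \<omega>)))
      = (LINT \<omega>|M. (\<Sum>a\<in>UNIV. \<Sum>b\<in>UNIV. (C $ i $ a * l $ b) *
          (x ?t \<omega> $ a * (mu_word mu (\<sigma> # w) (int (length w)) \<omega> * r 0 \<omega> $ b))))"
  proof (intro Bochner_Integration.integral_cong refl)
    fix \<omega>
    define m where "m = mu_word mu (\<sigma> # w) (int (length w)) \<omega>"
    have "(C *v x ?t \<omega>) $ i * (m * (l \<bullet> r 0 \<omega>))
        = (\<Sum>a\<in>UNIV. C $ i $ a * x ?t \<omega> $ a) * (\<Sum>b\<in>UNIV. m * (l $ b * r 0 \<omega> $ b))"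
      by (simp add: matrix_vector_mult_def inner_vec_def sum_distrib_left)
    also have "\<dots> = (\<Sum>a\<in>UNIV. \<Sum>b\<in>UNIV. (C $ i $ a * l $ b) * (x ?t \<omega> $ a * (m * r 0 \<omega> $ b)))"
      unfolding sum_product by (simp add: mult_ac)
    finally show "(C *v x ?t \<omega>) $ i * (mu_word mu (\<sigma> # w) (int (length w)) \<omega> * (l \<bullet> r 0 \<omega>))
        = (\<Sum>a\<in>UNIV. \<Sum>b\<in>UNIV. (C $ i $ a * l $ b) *
            (x ?t \<omega> $ a * (mu_word mu (\<sigma> # w) (int (length w)) \<omega> * r 0 \<omega> $ b)))"
      by (simp only: m_def)
  qed
  also have "\<dots> = (\<Sum>a\<in>UNIV. \<Sum>b\<in>UNIV. (C $ i $ a * l $ b) * state_moment (\<sigma> # w) ?t a b)"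
    using int by (simp add: Bochner_Integration.integral_sum state_moment_def)
  also have "\<dots> = p_word p w * (C *v (N *v l)) $ i"
    unfolding state_moment_word N_def[symmetric]
    by (simp add: matrix_vector_mult_def sum_distrib_left mult_ac)
  finally show ?thesis
    by (simp add: N_def matrix_vector_mul_assoc)
qed

lemma output_noise_moment:
  "(LINT \<omega>|M. (C *v x (int (length w) + 1) \<omega>) $ i * (mu_word mu (\<sigma> # w) (int (length w)) \<omega> * v 0 \<omega> $ j))
     = p_word p w * (C ** word_mat A w ** (K \<sigma> ** Q \<sigma>)) $ i $ j"
proof -
  have "vstack 0 (axis j 1) \<bullet> r 0 \<omega> = v 0 \<omega> $ j" for \<omega>
    by (simp add: inner_vec_def sum_Plus_UNIV axis_def if_distrib if_distribR cong: if_cong)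
  moreover have "(C *v (word_mat A w *v (K \<sigma> ** Q \<sigma> *v axis j 1))) $ i
      = (C ** word_mat A w ** (K \<sigma> ** Q \<sigma>)) $ i $ j"
    unfolding matrix_mult_column by (simp add: matrix_vector_mul_assoc matrix_vector_mult_basis)
  ultimately show ?thesis
    using output_moment[of w i \<sigma> "vstack 0 (axis j 1)"] by (simp add: hstack_mult_vstack)
qed

lemma output_output_moment:
  "(LINT \<omega>|M. (C *v x (int (length w) + 1) \<omega>) $ i *
      (mu_word mu (\<sigma> # w) (int (length w)) \<omega> * (C *v x 0 \<omega> + F *v v 0 \<omega>) $ j))
     = p_word p w * sqrt (p \<sigma>) * (C ** word_mat A w ** G_mat M mu p A K C F v x \<sigma>) $ i $ j"
proof -
  have "vstack (C $ j) (F $ j) \<bullet> r 0 \<omega> = (C *v x 0 \<omega> + F *v v 0 \<omega>) $ j" for \<omega>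
    by (simp add: inner_vec_def sum_Plus_UNIV matrix_vector_mult_def)
  moreover have "hstack (A \<sigma> ** P \<sigma>) (K \<sigma> ** Q \<sigma>) *v vstack (C $ j) (F $ j)
      = sqrt (p \<sigma>) *\<^sub>R column j (G_mat M mu p A K C F v x \<sigma>)"
    using p_pos[of \<sigma>]
    by (simp add: vec_eq_iff G_mat_def hstack_mult_vstack column_def matrix_mult_transpose_nth)
  moreover have "(C *v (word_mat A w *v column j G)) $ i = (C ** word_mat A w ** G) $ i $ j" for G :: "real ^ 'y ^ 'n"
    by (simp add: matrix_mult_column matrix_vector_mul_assoc)
  ultimately show ?thesis
    using output_moment[of w i \<sigma> "vstack (C $ j) (F $ j)"]
    by (simp add: matrix_vector_mult_scaleR)
qed

end

section \<open>Uniqueness of innovation representations\<close>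

text \<open>Each system is analysed with its own state process; the two states are never correlated with each
  other, as nothing is assumed about their joint conditional independence of \<open>\<mu>\<close>. They only meet in the almost sure
  equality of \<open>C x\<close> and \<open>C' x'\<close>, which are both the output minus the noise term.\<close>

theorem asGLSS_isomorphism:
  fixes M :: "'w measure" and mu :: "('w, 's::finite) process"
    and A :: "'s \<Rightarrow> real ^ 'n::finite ^ 'n" and K :: "'s \<Rightarrow> real ^ 'k::finite ^ 'n"
    and C :: "real ^ 'n ^ 'y::finite" and F :: "real ^ 'k ^ 'y"
    and A' :: "'s \<Rightarrow> real ^ 'm::finite ^ 'm" and K' :: "'s \<Rightarrow> real ^ 'k ^ 'm"
    and C' :: "real ^ 'm ^ 'y"
  assumes "prob_space M" and "admissible M mu E p"
    and reach: "reachable M mu E p y A K C F v" and reach': "reachable M mu E p y A' K' C' F v"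
    and obs: "observable A C" and obs': "observable A' C'"
    and noise: "\<And>\<sigma>. invertible (mu_moment M mu \<sigma> 0 v v)"
  obtains T :: "real ^ 'n ^ 'm" where "invertible T"
    and "\<And>\<sigma>. T ** A \<sigma> = A' \<sigma> ** T" and "\<And>\<sigma>. T ** K \<sigma> = K' \<sigma>" and "C = C' ** T"
proof -
  obtain x :: "('w, 'n) process" where x: "asGLSS_state M mu E p y A K C F v x"
    and span: "span (\<Union>w \<sigma>. columns (word_mat A w ** G_mat M mu p A K C F v x \<sigma>)) = UNIV"
    using reach unfolding reachable_def by auto
  obtain x' :: "('w, 'm) process" where x': "asGLSS_state M mu E p y A' K' C' F v x'"
    and span': "span (\<Union>w \<sigma>. columns (word_mat A' w ** G_mat M mu p A' K' C' F v x' \<sigma>)) = UNIV"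
    using reach' unfolding reachable_def by auto
  interpret prob_space M by fact
  interpret S: switched_system M mu E p y A K C F v x
    using assms(2) x noise by unfold_locales
  interpret S': switched_system M mu E p y A' K' C' F v x'
    using x' noise by unfold_locales
  define G where "G = G_mat M mu p A K C F v x"
  define G' where "G' = G_mat M mu p A' K' C' F v x'"
  have measurable [measurable]:
    "(\<lambda>\<omega>. (C *v x t \<omega>) $ i) \<in> borel_measurable M" "(\<lambda>\<omega>. (C' *v x' t \<omega>) $ i) \<in> borel_measurable M"
    "(\<lambda>\<omega>. (F *v v t \<omega>) $ i) \<in> borel_measurable M" "mu_word mu w t \<in> borel_measurable M"
    "(\<lambda>\<omega>. v t \<omega> $ j) \<in> borel_measurable M" for t i j w
    using S.x_measurable S'.x_measurable S.v_measurable S.mu_word_measurable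
    by (simp_all add: matrix_vector_mult_def)
  have same_output: "AE \<omega> in M. C *v x t \<omega> = C' *v x' t \<omega>" for t
    using S.output_eq[of t] S'.output_eq[of t] by eventually_elim simp
  have markov: "C ** word_mat A w ** K \<sigma> = C' ** word_mat A' w ** K' \<sigma>" for w \<sigma>
  proof (rule invertible_mult_right_cancel[OF noise])
    have "p_word p w * (C ** word_mat A w ** (K \<sigma> ** S.Q \<sigma>)) $ i $ j
        = p_word p w * (C' ** word_mat A' w ** (K' \<sigma> ** S.Q \<sigma>)) $ i $ j" for i j
      unfolding S.output_noise_moment[symmetric] S'.output_noise_moment[symmetric]
    proof (rule integral_cong_AE)
      show "AE \<omega> in M. (C *v x (int (length w) + 1) \<omega>) $ i * (mu_word mu (\<sigma> # w) (int (length w)) \<omega> * v 0 \<omega> $ j)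
          = (C' *v x' (int (length w) + 1) \<omega>) $ i * (mu_word mu (\<sigma> # w) (int (length w)) \<omega> * v 0 \<omega> $ j)"
        using same_output[of "int (length w) + 1"] by eventually_elim simp
    qed measurable
    then show "C ** word_mat A w ** K \<sigma> ** S.Q \<sigma> = C' ** word_mat A' w ** K' \<sigma> ** S.Q \<sigma>"
      using S.p_word_pos[of w] by (simp add: vec_eq_iff matrix_mul_assoc)
  qed
  have covariance: "C ** word_mat A w ** G \<sigma> = C' ** word_mat A' w ** G' \<sigma>" for w \<sigma>
  proof -
    have "p_word p w * sqrt (p \<sigma>) * (C ** word_mat A w ** G \<sigma>) $ i $ j
        = p_word p w * sqrt (p \<sigma>) * (C' ** word_mat A' w ** G' \<sigma>) $ i $ j" for i j
      unfolding G_def G'_def S.output_output_moment[symmetric] S'.output_output_moment[symmetric]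
    proof (rule integral_cong_AE)
      show "AE \<omega> in M. (C *v x (int (length w) + 1) \<omega>) $ i *
            (mu_word mu (\<sigma> # w) (int (length w)) \<omega> * (C *v x 0 \<omega> + F *v v 0 \<omega>) $ j)
          = (C' *v x' (int (length w) + 1) \<omega>) $ i *
            (mu_word mu (\<sigma> # w) (int (length w)) \<omega> * (C' *v x' 0 \<omega> + F *v v 0 \<omega>) $ j)"
        using same_output[of "int (length w) + 1"] same_output[of 0] by eventually_elim simp
    qed (unfold vector_add_component, measurable)
    then show ?thesis
      using S.p_word_pos[of w] S.p_pos[of \<sigma>] by (simp add: vec_eq_iff)
  qed
  have "\<exists>T :: real ^ 'n ^ 'm. invertible T \<and>
      (\<forall>a b. (\<forall>w. (C ** word_mat A w) *v a = (C' ** word_mat A' w) *v b) \<longrightarrow> T *v a = b) \<and>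
      (\<forall>\<sigma>. T ** A \<sigma> = A' \<sigma> ** T) \<and> C = C' ** T"
  proof (rule realization_isomorphism[of C A "\<lambda>(\<sigma>, j). column j (G \<sigma>)" C' A' "\<lambda>(\<sigma>, j). column j (G' \<sigma>)"])
    show "(C ** word_mat A w) *v (case i of (\<sigma>, j) \<Rightarrow> column j (G \<sigma>))
        = (C' ** word_mat A' w) *v (case i of (\<sigma>, j) \<Rightarrow> column j (G' \<sigma>))" for w i
      using covariance[of w "fst i"] by (simp add: split_beta flip: column_mult)
    show "span (range (\<lambda>(w, i). word_mat A w *v (case i of (\<sigma>, j) \<Rightarrow> column j (G \<sigma>)))) = UNIV"
      using span unfolding reachable_columns G_def by (simp add: split_beta)
    show "span (range (\<lambda>(w, i). word_mat A' w *v (case i of (\<sigma>, j) \<Rightarrow> column j (G' \<sigma>)))) = UNIV"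
      using span' unfolding reachable_columns G'_def by (simp add: split_beta)
  qed (use obs obs' in blast)+
  then obtain T :: "real ^ 'n ^ 'm" where T: "invertible T"
    and rel: "\<And>a b. \<forall>w. (C ** word_mat A w) *v a = (C' ** word_mat A' w) *v b \<Longrightarrow> T *v a = b"
    and "\<And>\<sigma>. T ** A \<sigma> = A' \<sigma> ** T" "C = C' ** T"
    by metis
  moreover have "T ** K \<sigma> = K' \<sigma>" for \<sigma>
    unfolding matrix_eq_columns column_mult
    using markov[of _ \<sigma>] by (intro allI rel) (simp flip: column_mult)
  ultimately show ?thesis
    using that by blast
qed

text \<open>Only \<open>B\<close> remains to be matched once \<open>asGLSS_isomorphism\<close> is applied, and the range
  inclusion expresses both of its versions through the noise gains.\<close>

theorem corollary3:
  fixes M :: "'w measure"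
    and mu :: "('w, 's::finite) process"
    and E :: "('s \<times> 's) set"
    and p :: "'s \<Rightarrow> real"
    and u :: "('w, 'u::finite) process"
    and y yd ys es :: "('w, 'y::finite) process"
    and A :: "'s \<Rightarrow> real ^ 'n::finite ^ 'n"
    and K :: "'s \<Rightarrow> real ^ 'y ^ 'n"
    and B :: "'s \<Rightarrow> real ^ 'u ^ 'n"
    and C :: "real ^ 'n ^ 'y"
    and D :: "real ^ 'u ^ 'y"
    and A' :: "'s \<Rightarrow> real ^ 'm::finite ^ 'm"
    and K' :: "'s \<Rightarrow> real ^ 'y ^ 'm"
    and B' :: "'s \<Rightarrow> real ^ 'u ^ 'm"
    and C' :: "real ^ 'm ^ 'y"
    and D' :: "real ^ 'u ^ 'y"
  assumes "prob_space M"
    and "admissible M mu E p"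
    and "white_noise M mu E p u"
    and "zmwssi M mu p (pstack y u)"
    and "is_det_component M mu p u y yd"
    and "ys = (\<lambda>t \<omega>. y t \<omega> - yd t \<omega>)"
    and "is_innovation M mu p ys es"
    and "sGLSS M mu E p y u A K B C D (mat 1) es"
    and "sGLSS M mu E p y u A' K' B' C' D' (mat 1) es"
    and "asGLSS M mu E p ys A K C (mat 1) es"
    and "asGLSS M mu E p ys A' K' C' (mat 1) es"
    and "reachable M mu E p ys A K C (mat 1) es"
    and "reachable M mu E p ys A' K' C' (mat 1) es"
    and "observable A C"
    and "observable A' C'"
    and "\<And>\<sigma> t. invertible (mu_moment M mu \<sigma> t es es)"
    and "\<And>\<sigma>. range ((*v) (vstack (B \<sigma>) (B' \<sigma>))) \<subseteq> range ((*v) (vstack (K \<sigma>) (K' \<sigma>)))"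
    and "D' = D"
  shows "\<exists>T :: real ^ 'n ^ 'm. invertible T \<and>
           (\<forall>\<sigma>. T ** A \<sigma> ** matrix_inv T = A' \<sigma> \<and>
                T ** hstack (K \<sigma>) (B \<sigma>) = hstack (K' \<sigma>) (B' \<sigma>)) \<and>
           C ** matrix_inv T = C'"
proof -
  obtain T :: "real ^ 'n ^ 'm" where T: "invertible T" and TA: "\<And>\<sigma>. T ** A \<sigma> = A' \<sigma> ** T"
    and TK: "\<And>\<sigma>. T ** K \<sigma> = K' \<sigma>" and TC: "C = C' ** T"
    using asGLSS_isomorphism[OF assms(1,2,12-15) assms(16)] by blast
  have TB: "T ** B \<sigma> = B' \<sigma>" for \<sigma>
  proof -
    have "(T ** B \<sigma>) *v z = B' \<sigma> *v z" for z
    proof -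
      have "vstack (B \<sigma>) (B' \<sigma>) *v z \<in> range ((*v) (vstack (K \<sigma>) (K' \<sigma>)))"
        using assms(17) by blast
      then obtain q where "B \<sigma> *v z = K \<sigma> *v q" "B' \<sigma> *v z = K' \<sigma> *v q"
        by (auto simp: vstack_mult vstack_eq_iff)
      then show ?thesis
        using TK[of \<sigma>] by (metis matrix_vector_mul_assoc)
    qed
    then show ?thesis
      by (simp add: matrix_eq)
  qed
  show ?thesis
  proof (intro exI conjI allI)
    show "T ** A \<sigma> ** matrix_inv T = A' \<sigma>" for \<sigma>
      using matrix_inv_works(1)[OF T] by (simp add: TA flip: matrix_mul_assoc)
    show "T ** hstack (K \<sigma>) (B \<sigma>) = hstack (K' \<sigma>) (B' \<sigma>)" for \<sigma>
      by (simp add: hstack_mult TK TB)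
    show "C ** matrix_inv T = C'"
      using matrix_inv_works(1)[OF T] by (simp add: TC flip: matrix_mul_assoc)
  qed (rule T)
qed

end
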